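(* Let $n=N_0+N_1$ with $N_1\ge1$, and let $Z_1,\dots,Z_n$ be independent, where $N_1$ of them (the non-nulls) are $N(\mu,1)$ with a common $\mu>0$ and the remaining $N_0$ (the nulls) are $N(0,1)$; let $p_i=1-\Phi(Z_i)$. Let $\alpha,\beta\in(0,1)$. Consider the batch adaptively ordered martingale test: $M_0=\emptyset$, $M_k=M_{k-1}\cup\{i_k\}$ with $i_k\in\arg\min_{i\notin M_{k-1}}g(p_i)$, rejecting iff there exists $k\in\{1,\dots,n\}$ with $\sum_{i\in M_k}h(p_i)>C_k^\alpha k^{1/2}$. This test has power at least $1-\beta$ if there exists $j\in\{1,\dots,N_1\}$ such that $$\sum_{s=1}^j\big(2\,\mathbb P(Z_{(s)}(\mu)>0)-1\big)\ \ge\ \big(C_n^\alpha+C_n^{\beta/2}\big)\big(j+t_{\beta/(2N_1)}(N_0,q_j)\big)^{1/2}.$$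
   Context: $\Phi$ is the standard Gaussian CDF; $h(p)=2\cdot\mathbf 1\{p<0.5\}-1$ and $g(p)=\min\{p,1-p\}$. For $\gamma\in(0,1)$, $k\ge1$: $C_k^\gamma=1.7\sqrt{\log\log(2k)+0.72\log\frac{5.2}{\gamma}}$. $Z(\nu)$ denotes a $N(\nu,1)$ random variable. $Z_{(1)}(\mu),\dots,Z_{(N_1)}(\mu)$ denote $N_1$ i.i.d. $N(\mu,1)$ variables ordered so that $|Z_{(1)}(\mu)|\ge\dots\ge|Z_{(N_1)}(\mu)|$. $q_j:=\mathbb P(|Z(0)|>|Z_{(j)}(\mu)|)$ with $Z(0)$ independent of the $Z_{(s)}(\mu)$. For $X\sim\mathrm{Bin}(N,p)$, $t_\gamma(N,p)$ denotes the $\gamma$-upper quantile of $\mathrm{Bin}(N,p)$, i.e. $\mathbb P(X\ge t_\gamma(N,p))=\gamma$. Power is the probability of rejection.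
   Formalization: Since a binomial law generally has no t with P(X ≥ t) = γ exactly, the upper quantile t_γ(N,p) is taken to be the smallest integer t ≥ 0 with P(X ≥ t) ≤ γ, which agrees with the stated definition whenever an integer t attains equality. *)

theory Defs
  imports "HOL-Probability.Probability"
begin

definition gauss :: "real \<Rightarrow> real measure" where
  "gauss \<nu> = density lborel (normal_density \<nu> 1)"

definition Phi :: "real \<Rightarrow> real" where
  "Phi x = measure (gauss 0) {..x}"

definition hfun :: "real \<Rightarrow> real" where
  "hfun p = 2 * (if p < 1/2 then 1 else 0) - 1"

definition gfun :: "real \<Rightarrow> real" where
  "gfun p = min p (1 - p)"

definition Cconst :: "nat \<Rightarrow> real \<Rightarrow> real" where
  "Cconst k \<gamma> = 1.7 * sqrt (ln (ln (2 * real k)) + 0.72 * ln (5.2 / \<gamma>))"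

definition binom_upper_quantile :: "real \<Rightarrow> nat \<Rightarrow> real \<Rightarrow> nat" where
  "binom_upper_quantile \<gamma> N p =
     (LEAST t. measure_pmf.prob (binomial_pmf N p) {t..} \<le> \<gamma>)"

(* 0-based position of index i when x_0..x_{N-1} are ordered by decreasing |x_l|
   (ties, a null event, broken by index) *)
definition absrank :: "nat \<Rightarrow> (nat \<Rightarrow> real) \<Rightarrow> nat \<Rightarrow> nat" where
  "absrank N x i = card {l. l < N \<and> (\<bar>x l\<bar> > \<bar>x i\<bar> \<or> (\<bar>x l\<bar> = \<bar>x i\<bar> \<and> l < i))}"

(* order statistic Z_(s), s = 1..N, with |Z_(1)| >= ... >= |Z_(N)| *)
definition ord_stat :: "nat \<Rightarrow> (nat \<Rightarrow> real) \<Rightarrow> nat \<Rightarrow> real" where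
  "ord_stat N x s = (\<Sum>i<N. if absrank N x i = s - 1 then x i else 0)"

definition iid_gauss :: "nat \<Rightarrow> real \<Rightarrow> (nat \<Rightarrow> real) measure" where
  "iid_gauss N \<mu> = PiM {..<N} (\<lambda>_. gauss \<mu>)"

definition qprob :: "nat \<Rightarrow> real \<Rightarrow> nat \<Rightarrow> real" where
  "qprob N1 \<mu> j = measure (gauss 0 \<Otimes>\<^sub>M iid_gauss N1 \<mu>)
      ({(z, x). \<bar>z\<bar> > \<bar>ord_stat N1 x j\<bar>} \<inter> space (gauss 0 \<Otimes>\<^sub>M iid_gauss N1 \<mu>))"

definition pval :: "(nat \<Rightarrow> real) \<Rightarrow> nat \<Rightarrow> real" where
  "pval Z i = 1 - Phi (Z i)"

(* greedy adaptive ordering: 0-based step at which i is added, i.e. rank of i by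
   increasing g(p_i), argmin ties broken by smallest index *)
definition grank :: "nat \<Rightarrow> (nat \<Rightarrow> real) \<Rightarrow> nat \<Rightarrow> nat" where
  "grank n Z i = card {l. l < n \<and> (gfun (pval Z l) < gfun (pval Z i) \<or>
                         (gfun (pval Z l) = gfun (pval Z i) \<and> l < i))}"

definition Mset :: "nat \<Rightarrow> (nat \<Rightarrow> real) \<Rightarrow> nat \<Rightarrow> nat set" where
  "Mset n Z k = {i. i < n \<and> grank n Z i < k}"

definition rejects :: "nat \<Rightarrow> real \<Rightarrow> (nat \<Rightarrow> real) \<Rightarrow> bool" where
  "rejects n \<alpha> Z \<longleftrightarrow>
     (\<exists>k\<in>{1..n}. (\<Sum>i\<in>Mset n Z k. hfun (pval Z i)) > Cconst k \<alpha> * sqrt (real k))"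

definition data_law :: "nat \<Rightarrow> nat set \<Rightarrow> real \<Rightarrow> (nat \<Rightarrow> real) measure" where
  "data_law n S \<mu> = PiM {..<n} (\<lambda>i. if i \<in> S then gauss \<mu> else gauss 0)"

end

theory Submission
  imports Defs "HOL-Combinatorics.Permutations"
begin

text \<open>
  The number of nulls ranked before the \<open>j\<close>-th non-null is a mixture of binomials rather than
  \<open>Bin(N\<^sub>0, q\<^sub>j)\<close>, so the random index of the \<open>j\<close>-th non-null is replaced by a deterministic threshold
  \<open>r\<close> with \<open>\<P>(\<bar>Z(\<mu>)\<bar> > r) = j / (N\<^sub>1 + 1)\<close>. The hypotheses with \<open>\<bar>Z\<^sub>i\<bar> > r\<close> form one of the sets \<open>M\<^sub>k\<close>, and
  their signs sum to a sum of independent bounded variables. Neyman--Pearson bounds its mean from below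
  by the sum in the hypothesis, up to an additive constant. Convexity of the null tail as a function
  of the non-null tail, Jensen's inequality and exchangeability give \<open>\<P>(\<bar>Z(0)\<bar> > r) \<le> q\<^sub>j\<close>, and the quantile
  dominates \<open>N\<^sub>0 q\<^sub>j\<close> up to a factor \<open>1 + 1/j\<close>. After linearizing the square root boundary at
  \<open>K = j + t\<close>, a Chernoff bound with \<open>\<theta> = C\<^sub>n\<^sup>\<beta>\<^sup>/\<^sup>2 / sqrt K\<close> yields failure probability at most
  \<open>exp (5/4 - (C\<^sub>n\<^sup>\<beta>\<^sup>/\<^sup>2)\<^sup>2 / 2) \<le> \<beta>\<close>; the additive constants lost on the way are absorbed by the factor 5.2
  in \<open>C\<close>.
\<close>

subsection \<open>Gaussian tails and signs\<close>

lemma prob_space_gauss: "prob_space (gauss \<nu>)"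
  unfolding gauss_def by (rule prob_space_normal_density) simp

lemma sets_gauss [simp, measurable_cong]: "sets (gauss \<nu>) = sets borel"
  by (simp add: gauss_def)

lemma space_gauss [simp]: "space (gauss \<nu>) = UNIV"
  by (simp add: gauss_def)

interpretation gauss: real_distribution "gauss \<nu>" for \<nu>
  by (intro real_distribution.intro real_distribution_axioms.intro prob_space_gauss) simp

lemma integral_gauss:
  assumes [measurable]: "f \<in> borel_measurable borel"
  shows "integral\<^sup>L (gauss \<nu>) f = (\<integral>y. normal_density \<nu> 1 y * f y \<partial>lborel)"
  unfolding gauss_def by (subst integral_density) auto

lemma integrable_normal_density_mult:
  assumes [measurable]: "f \<in> borel_measurable borel" and "\<And>y. \<bar>f y\<bar> \<le> B"
  shows "integrable lborel (\<lambda>y. normal_density \<nu> 1 y * f y)"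
proof -
  have "integrable (gauss \<nu>) f"
    by (rule gauss.integrable_const_bound[of _ B]) (use assms in auto)
  then show ?thesis
    unfolding gauss_def by (subst (asm) integrable_density) auto
qed

text \<open>The density is strictly positive, so the normal laws have exactly the Lebesgue null
  sets. This gives both the absence of atoms and the strict growth of \<open>Phi\<close>.\<close>

lemma gauss_null_iff:
  assumes [measurable]: "A \<in> sets borel"
  shows "measure (gauss \<nu>) A = 0 \<longleftrightarrow> emeasure lborel A = 0"
proof -
  have "measure (gauss \<nu>) A = 0 \<longleftrightarrow> A \<in> null_sets (gauss \<nu>)"
    by (auto simp: null_sets_def gauss.emeasure_eq_measure)
  also have "\<dots> \<longleftrightarrow> (AE x in lborel. x \<in> A \<longrightarrow> ennreal (normal_density \<nu> 1 x) = 0)"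
    unfolding gauss_def by (subst null_sets_density_iff) simp_all
  also have "\<dots> \<longleftrightarrow> (AE x in lborel. x \<notin> A)"
  proof (intro AE_cong)
    fix x :: real
    show "(x \<in> A \<longrightarrow> ennreal (normal_density \<nu> 1 x) = 0) = (x \<notin> A)"
      using normal_density_pos[of 1 \<nu> x] by auto
  qed
  also have "\<dots> \<longleftrightarrow> emeasure lborel A = 0"
    by (subst AE_iff_measurable[of A]) auto
  finally show ?thesis .
qed

lemma gauss_singleton [simp]: "measure (gauss \<nu>) {x} = 0"
  by (subst gauss_null_iff) auto

text \<open>Reflection preserves Lebesgue measure, so twice the integral is that of
  \<open>g y + g (- y)\<close>. Integral comparisons thus reduce to a pointwise sign on each pair
  \<open>y\<close>, \<open>- y\<close>, even where \<open>g\<close> itself changes sign.\<close>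

lemma integral_lborel_nonneg_symmetrized:
  fixes g :: "real \<Rightarrow> real"
  assumes "integrable lborel g" and "\<And>y. 0 \<le> g y + g (- y)"
  shows "0 \<le> integral\<^sup>L lborel g"
proof -
  have eq: "(\<integral>y. g (- y) \<partial>lborel) = integral\<^sup>L lborel g"
    using lborel_integral_real_affine[of "-1" g 0] by simp
  have int: "integrable lborel (\<lambda>y. g (- y))"
    using lborel_integrable_real_affine[OF assms(1), of "-1" 0] by simp
  have "0 \<le> (\<integral>y. g y + g (- y) \<partial>lborel)"
    using assms(2) by (intro Bochner_Integration.integral_nonneg) auto
  also have "\<dots> = 2 * integral\<^sup>L lborel g"
    using assms(1) int eq by simp
  finally show ?thesis by simp
qed

lemma normal_density_uminus: "normal_density 0 1 (- y) = normal_density 0 1 y"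
  by (simp add: normal_density_def)

lemma Phi_strict_mono: "strict_mono Phi"
proof (rule strict_monoI)
  fix x y :: real assume xy: "x < y"
  have "measure (gauss 0) {x<..y} \<noteq> 0"
    using xy by (subst gauss_null_iff) auto
  moreover have "Phi y - Phi x = measure (gauss 0) {x<..y}"
    using gauss.cdf_diff_eq[OF xy, of 0] by (simp add: Phi_def cdf_def)
  ultimately show "Phi x < Phi y"
    using measure_nonneg[of "gauss 0" "{x<..y}"] by linarith
qed

lemma Phi_uminus: "Phi (- x) = 1 - Phi x"
proof -
  have 1: "distr (gauss 0) borel uminus = gauss 0"
  proof -
    have "distr (gauss 0) borel uminus = distr (density lborel (normal_density 0 1)) lborel uminus"
      by (simp add: gauss_def cong: distr_cong)
    also have "\<dots> = density (distr lborel lborel uminus) (normal_density 0 1)"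
      by (subst density_distr) (auto simp: normal_density_uminus)
    also have "distr lborel lborel uminus = (lborel :: real measure)"
      using lborel_distr_uminus by (simp cong: distr_cong)
    finally show ?thesis by (simp add: gauss_def)
  qed
  have "Phi (- x) = measure (distr (gauss 0) borel uminus) {.. - x}"
    by (simp add: Phi_def 1)
  also have "\<dots> = measure (gauss 0) {x..}"
    by (subst measure_distr) (auto intro!: arg_cong[where f = "measure (gauss 0)"])
  also have "{x..} = {x} \<union> (UNIV - {..x})" by auto
  also have "measure (gauss 0) \<dots> = measure (gauss 0) {x} + measure (gauss 0) (UNIV - {..x})"
    by (intro gauss.finite_measure_Union) auto
  also have "\<dots> = 1 - Phi x"
    using gauss.prob_compl[of "{..x}" 0] by (simp add: Phi_def)
  finally show ?thesis .
qed

lemma Phi_gt_half_iff: "Phi x > 1 / 2 \<longleftrightarrow> x > 0"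
proof -
  have "Phi 0 = 1 / 2" using Phi_uminus[of 0] by simp
  then show ?thesis using strict_mono_less[OF Phi_strict_mono, of 0 x] by metis
qed

text \<open>With \<open>gfun_pval\<close> this removes the p-values: the test sees
  \<open>Z i\<close> only through its sign and its absolute value.\<close>

lemma hfun_pval: "hfun (pval Z i) = (if Z i > 0 then 1 else - 1)"
  using Phi_gt_half_iff[of "Z i"] by (auto simp: hfun_def pval_def)

text \<open>The two candidates for the minimum are \<open>Phi (- Z i)\<close> and
  \<open>Phi (Z i)\<close>, and \<open>Phi\<close> is monotone; so the greedy order is the order of
  decreasing absolute value.\<close>

lemma gfun_pval: "gfun (pval Z i) = Phi (- \<bar>Z i\<bar>)"
proof -
  have "Phi x \<le> Phi y \<longleftrightarrow> x \<le> y" for x y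
    using strict_mono_less_eq[OF Phi_strict_mono] .
  then show ?thesis
    by (auto simp: gfun_def pval_def min_def Phi_uminus[symmetric] abs_if)
qed

section \<open>Two-sided Gaussian tails as functions of the threshold\<close>

definition gtail :: "real \<Rightarrow> real \<Rightarrow> real" where
  "gtail \<nu> r = measure (gauss \<nu>) {y. \<bar>y\<bar> > r}"

text \<open>The points \<open>r\<close> and \<open>- r\<close> carry no mass. The exchangeability
  argument delivers the weak inequality, whereas \<open>gtail\<close> has the strict one.\<close>

lemma gtail_ge:
  assumes "0 \<le> r" shows "measure (gauss \<nu>) {y. \<bar>y\<bar> \<ge> r} = gtail \<nu> r"
proof -
  have "measure (gauss \<nu>) {y. \<bar>y\<bar> \<ge> r} = measure (gauss \<nu>) ({y. \<bar>y\<bar> > r} \<union> {r, -r})"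
    using assms by (intro arg_cong[where f = "measure (gauss \<nu>)"]) auto
  also have "\<dots> = measure (gauss \<nu>) {y. \<bar>y\<bar> > r}"
    by (rule measure_Un_null_set) (auto simp: null_sets_def gauss.emeasure_eq_measure gauss_null_iff
         emeasure_lborel_countable)
  finally show ?thesis by (simp add: gtail_def)
qed

lemma gtail_eq_cdf:
  assumes "0 \<le> r" shows "gtail \<nu> r = 1 - cdf (gauss \<nu>) r + cdf (gauss \<nu>) (- r)"
proof -
  have "gtail \<nu> r = measure (gauss \<nu>) {y. \<bar>y\<bar> \<ge> r}" using gtail_ge[OF assms] by simp
  also have "\<dots> = measure (gauss \<nu>) ({r} \<union> ((UNIV - {..r}) \<union> {..-r}))"
    using assms by (intro arg_cong[where f = "measure (gauss \<nu>)"]) auto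
  also have "\<dots> = measure (gauss \<nu>) ((UNIV - {..r}) \<union> {..-r})"
    by (subst Un_commute, rule measure_Un_null_set)
       (auto simp: null_sets_def gauss.emeasure_eq_measure)
  also have "\<dots> = 1 - cdf (gauss \<nu>) r + cdf (gauss \<nu>) (- r)" if "r > 0"
    using gauss.prob_compl[of "{..r}" \<nu>] that
    by (subst gauss.finite_measure_Union) (auto simp: cdf_def)
  moreover have "measure (gauss \<nu>) ((UNIV - {..r}) \<union> {..-r}) = 1" if "r = 0"
  proof -
    have "(UNIV - {..r}) \<union> {..-r} = UNIV" using that by auto
    then show ?thesis using gauss.prob_space[of \<nu>] by simp
  qed
  ultimately show ?thesis using assms by (cases "r = 0") auto
qed

text \<open>Intermediate values: without atoms the tail is continuous, it equals \<open>1\<close> at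
  \<open>0\<close> and tends to \<open>0\<close>. It supplies the deterministic threshold with a
  prescribed non-null tail.\<close>

lemma gtail_surj:
  assumes "0 < u" "u < 1"
  obtains r where "0 \<le> r" "gtail \<nu> r = u"
proof -
  define f where "f r = 1 - cdf (gauss \<nu>) r + cdf (gauss \<nu>) (- r)" for r
  have cont: "isCont (cdf (gauss \<nu>)) x" for x
    by (subst gauss.isCont_cdf) simp
  have contf: "isCont f x" for x
    unfolding f_def by (intro continuous_intros cont isCont_o2[OF _ cont])
  have "(f \<longlongrightarrow> 1 - 1 + 0) at_top"
    unfolding f_def
    by (intro tendsto_intros gauss.cdf_lim_at_top_prob
          filterlim_compose[OF gauss.cdf_lim_at_bot] filterlim_uminus_at_bot_at_top)
  then have "eventually (\<lambda>r. f r < u) at_top"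
    using assms by (intro order_tendstoD) auto
  then obtain R where R: "\<And>r. r \<ge> R \<Longrightarrow> f r < u"
    by (auto simp: eventually_at_top_linorder)
  have "f 0 = 1" by (simp add: f_def)
  then have "\<exists>r\<ge>0. r \<le> max R 0 \<and> f r = u"
    using R[of "max R 0"] assms contf by (intro IVT2) auto
  then show ?thesis using that by (metis f_def gtail_eq_cdf)
qed

lemma gtail_antimono: "r \<le> r' \<Longrightarrow> gtail \<nu> r' \<le> gtail \<nu> r"
  unfolding gtail_def by (intro gauss.finite_measure_mono) auto

lemma gtail_measurable [measurable]: "gtail \<nu> \<in> borel_measurable borel"
proof -
  have "mono (\<lambda>r. - gtail \<nu> r)" by (rule monoI) (simp add: gtail_antimono)
  then have "(\<lambda>r. - (- gtail \<nu> r)) \<in> borel_measurable borel"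
    by (intro borel_measurable_uminus borel_measurable_mono)
  then show ?thesis by simp
qed

lemma gtail_integral:
  "gtail \<nu> r = (\<integral>y. normal_density \<nu> 1 y * indicator {y. \<bar>y\<bar> > r} y \<partial>lborel)"
proof -
  have "gtail \<nu> r = integral\<^sup>L (gauss \<nu>) (indicator {y. \<bar>y\<bar> > r})"
    by (simp add: gtail_def)
  also have "\<dots> = (\<integral>y. normal_density \<nu> 1 y * indicator {y. \<bar>y\<bar> > r} y \<partial>lborel)"
    by (subst integral_gauss) auto
  finally show ?thesis .
qed

lemma normal_density_shift:
  "normal_density \<mu> 1 y = normal_density 0 1 y * exp (\<mu> * y) / exp (\<mu>\<^sup>2 / 2)"
  by (simp add: normal_density_def exp_add[symmetric] exp_diff[symmetric] power2_eq_square field_simps)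

lemma cosh_abs_mono:
  fixes x y :: real assumes "\<bar>x\<bar> \<le> \<bar>y\<bar>" shows "cosh x \<le> cosh y"
  using cosh_real_nonneg_le_iff[of "\<bar>x\<bar>" "\<bar>y\<bar>"] assms by (simp add: cosh_real_abs)

text \<open>The likelihood ratio of \<open>\<bar>Z(\<mu>)\<bar>\<close> against \<open>\<bar>Z(0)\<bar>\<close> is increasing, so the null tail
  probability is a convex function of the non-null one; this is the tangent line at \<open>r0\<close>.\<close>
lemma gtail_tangent:
  assumes "0 \<le> r" "0 \<le> r0"
  shows "gtail 0 r - gtail 0 r0 \<ge> exp (\<mu>\<^sup>2 / 2) / cosh (\<mu> * r0) * (gtail \<mu> r - gtail \<mu> r0)"
proof -
  \<comment> \<open>The slope is the reciprocal of the likelihood ratio of the absolute values at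
    \<open>r0\<close>, which is \<open>cosh (\<mu> * r0) / exp (\<mu>\<^sup>2 / 2)\<close>.\<close>
  define \<kappa> where "\<kappa> = exp (\<mu>\<^sup>2 / 2) / cosh (\<mu> * r0)"
  define V :: "real \<Rightarrow> real" where "V y = indicator {y. \<bar>y\<bar> > r} y - indicator {y. \<bar>y\<bar> > r0} y" for y
  have [measurable]: "V \<in> borel_measurable borel" unfolding V_def by measurable
  have V1: "\<bar>V y\<bar> \<le> 1" for y by (auto simp: V_def indicator_def)
  have I: "integrable lborel (\<lambda>y. normal_density \<nu> 1 y * V y)" for \<nu>
    using V1 by (intro integrable_normal_density_mult) auto
  have D: "gtail \<nu> r - gtail \<nu> r0 = (\<integral>y. normal_density \<nu> 1 y * V y \<partial>lborel)" for \<nu>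
    unfolding gtail_integral V_def right_diff_distrib
    by (intro Bochner_Integration.integral_diff[symmetric] integrable_normal_density_mult[where B = 1])
       (auto simp: indicator_def)
  have "0 \<le> (\<integral>y. normal_density 0 1 y * V y - \<kappa> * (normal_density \<mu> 1 y * V y) \<partial>lborel)"
  proof (rule integral_lborel_nonneg_symmetrized)
    show "integrable lborel (\<lambda>y. normal_density 0 1 y * V y - \<kappa> * (normal_density \<mu> 1 y * V y))"
      using I by auto
    fix y :: real
    have Vs: "V (- y) = V y" by (simp add: V_def indicator_def)
    have "normal_density \<mu> 1 y + normal_density \<mu> 1 (- y) =
        normal_density 0 1 y * (2 * cosh (\<mu> * y)) / exp (\<mu>\<^sup>2 / 2)"
      unfolding normal_density_shift[of \<mu>] normal_density_uminus
      by (simp add: cosh_def field_simps)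
    then have "\<kappa> * (normal_density \<mu> 1 y + normal_density \<mu> 1 (- y)) =
        normal_density 0 1 y * (2 * cosh (\<mu> * y) / cosh (\<mu> * r0))"
      by (simp add: \<kappa>_def)
    note \<kappa>_eq = this
    have eq: "normal_density 0 1 y * V y - \<kappa> * (normal_density \<mu> 1 y * V y) +
       (normal_density 0 1 (- y) * V (- y) - \<kappa> * (normal_density \<mu> 1 (- y) * V (- y)))
       = 2 * normal_density 0 1 y * (V y * (1 - cosh (\<mu> * y) / cosh (\<mu> * r0)))"
      (is "?L = _")
    proof -
      have "?L = V y * (2 * normal_density 0 1 y - \<kappa> * (normal_density \<mu> 1 y + normal_density \<mu> 1 (- y)))"
        unfolding Vs normal_density_uminus by (simp add: algebra_simps)
      then show ?thesis unfolding \<kappa>_eq by (simp add: algebra_simps)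
    qed
    \<comment> \<open>Both factors change sign at \<open>\<bar>y\<bar> = r0\<close>: inside,
      \<open>V y\<close> is at least \<open>0\<close> and the \<open>cosh\<close> ratio at most
      \<open>1\<close>; outside, both are reversed.\<close>
    have "0 \<le> V y * (1 - cosh (\<mu> * y) / cosh (\<mu> * r0))"
    proof (cases "\<bar>y\<bar> \<le> r0")
      case True
      then have "\<bar>\<mu> * y\<bar> \<le> \<bar>\<mu> * r0\<bar>" using assms by (simp add: abs_mult mult_left_mono)
      then have "cosh (\<mu> * y) / cosh (\<mu> * r0) \<le> 1"
        using cosh_abs_mono by simp
      moreover have "V y \<ge> 0" using True by (simp add: V_def indicator_def)
      ultimately show ?thesis by simp
    next
      case False
      then have "\<bar>\<mu> * r0\<bar> \<le> \<bar>\<mu> * y\<bar>" using assms by (simp add: abs_mult mult_left_mono)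
      then have "cosh (\<mu> * y) / cosh (\<mu> * r0) \<ge> 1"
        using cosh_abs_mono by simp
      moreover have "V y \<le> 0" using False by (simp add: V_def indicator_def)
      ultimately show ?thesis by (simp add: mult_nonpos_nonpos)
    qed
    then show "0 \<le> normal_density 0 1 y * V y - \<kappa> * (normal_density \<mu> 1 y * V y) +
       (normal_density 0 1 (- y) * V (- y) - \<kappa> * (normal_density \<mu> 1 (- y) * V (- y)))"
      unfolding eq by (intro mult_nonneg_nonneg[of "2 * normal_density 0 1 y"]) simp_all
  qed
  also have "\<dots> = (gtail 0 r - gtail 0 r0) - \<kappa> * (gtail \<mu> r - gtail \<mu> r0)"
    unfolding D using I by simp
  finally show ?thesis by (simp add: \<kappa>_def)
qed

text \<open>The value \<open>- 1\<close> at \<open>0\<close> matches \<open>hfun\<close> at the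
  p-value \<open>1 / 2\<close>, so that the two agree at every point and not merely almost
  everywhere.\<close>

definition sg :: "real \<Rightarrow> real" where
  "sg y = (if y > 0 then 1 else - 1)"

lemma sg_measurable [measurable]: "sg \<in> borel_measurable borel"
  unfolding sg_def by measurable

lemma abs_sg [simp]: "\<bar>sg y\<bar> = 1"
  by (simp add: sg_def)

text \<open>A Neyman--Pearson argument: given \<open>\<bar>Z(\<mu>)\<bar> = y\<close> the sign has mean \<open>tanh (\<mu> * y)\<close>, which exceeds
  \<open>a\<close> exactly for \<open>y > r0\<close>.\<close>
lemma gauss_threshold_optimal:
  assumes [measurable]: "V \<in> borel_measurable borel"
    and even: "\<And>y. V (- y) = V y" and V01: "\<And>y. 0 \<le> V y" "\<And>y. V y \<le> 1"
    and "\<mu> > 0" "0 \<le> r0"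
  defines "a \<equiv> tanh (\<mu> * r0)"
  shows "(\<integral>y. (sg y - a) * V y \<partial>gauss \<mu>) \<le> (\<integral>y. (sg y - a) * indicator {y. \<bar>y\<bar> > r0} y \<partial>gauss \<mu>)"
proof -
  define I :: "real \<Rightarrow> real" where "I = indicator {y. \<bar>y\<bar> > r0}"
  have [measurable]: "I \<in> borel_measurable borel" unfolding I_def by measurable
  have I01: "0 \<le> I y" "I y \<le> 1" for y by (auto simp: I_def indicator_def)
  have bd: "\<bar>(sg y - a) * U y\<bar> \<le> 1 + \<bar>a\<bar>" if "\<And>y. 0 \<le> U y" "\<And>y. U y \<le> 1" for U :: "real \<Rightarrow> real" and y
  proof -
    have "\<bar>sg y - a\<bar> * \<bar>U y\<bar> \<le> (1 + \<bar>a\<bar>) * 1"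
      using that[of y] by (intro mult_mono) (auto simp: sg_def)
    then show ?thesis by (simp add: abs_mult)
  qed
  have int: "integrable lborel (\<lambda>y. normal_density \<mu> 1 y * ((sg y - a) * U y))"
    if "U \<in> borel_measurable borel" "\<And>y. 0 \<le> U y" "\<And>y. U y \<le> 1" for U
    using bd[OF that(2,3)] that(1) by (intro integrable_normal_density_mult) auto
  have "0 \<le> (\<integral>y. normal_density \<mu> 1 y * ((sg y - a) * I y) - normal_density \<mu> 1 y * ((sg y - a) * V y) \<partial>lborel)"
  proof (rule integral_lborel_nonneg_symmetrized)
    show "integrable lborel (\<lambda>y. normal_density \<mu> 1 y * ((sg y - a) * I y) - normal_density \<mu> 1 y * ((sg y - a) * V y))"
      using int I01 V01 by (intro Bochner_Integration.integrable_diff) auto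
    have a1: "1 - a = exp (- (\<mu> * r0)) / cosh (\<mu> * r0)" "1 + a = exp (\<mu> * r0) / cosh (\<mu> * r0)"
      using cosh_minus_sinh[of "\<mu> * r0"] cosh_plus_sinh[of "\<mu> * r0"] cosh_real_pos[of "\<mu> * r0"]
      by (auto simp: a_def tanh_def field_simps)
    \<comment> \<open>The coefficient of the pair \<open>y\<close>, \<open>- y\<close> for
      \<open>y > 0\<close>: an even weight gains \<open>1 - a\<close> at \<open>y\<close> and loses
      \<open>1 + a\<close> at \<open>- y\<close>. By the choice of \<open>a\<close>,
      \<open>E y\<close> has the sign of \<open>y - r0\<close>.\<close>
    define E where "E y = (1 - a) * normal_density \<mu> 1 y - (1 + a) * normal_density \<mu> 1 (- y)" for y
    have E: "E y = normal_density 0 1 y / exp (\<mu>\<^sup>2 / 2) / cosh (\<mu> * r0) *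
        (exp (\<mu> * (y - r0)) - exp (- (\<mu> * (y - r0))))" for y
    proof -
      have e: "exp (\<mu> * (y - r0)) = exp (\<mu> * y) * exp (- (\<mu> * r0))"
        "exp (- (\<mu> * (y - r0))) = exp (- (\<mu> * y)) * exp (\<mu> * r0)"
        by (simp_all add: exp_add[symmetric] algebra_simps)
      show ?thesis
        unfolding E_def a1 normal_density_shift[of \<mu>] normal_density_uminus e
        by (simp add: diff_divide_distrib right_diff_distrib ac_simps)
    qed
    have pos: "0 \<le> (I y - V y) * E y" if "y > 0" for y
    proof (cases "y > r0")
      case True
      have "- (\<mu> * (y - r0)) \<le> \<mu> * (y - r0)" using True \<open>\<mu> > 0\<close> by simp
      then have "E y \<ge> 0" unfolding E
        by (intro mult_nonneg_nonneg divide_nonneg_nonneg) auto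
      moreover have "I y - V y \<ge> 0" using V01[of y] True that by (simp add: I_def indicator_def)
      ultimately show ?thesis by simp
    next
      case False
      have "\<mu> * (y - r0) \<le> - (\<mu> * (y - r0))"
        using False \<open>\<mu> > 0\<close> mult_nonneg_nonpos[of \<mu> "y - r0"] by simp
      then have "E y \<le> 0" unfolding E
        by (intro mult_nonneg_nonpos divide_nonneg_nonneg) auto
      moreover have "I y - V y \<le> 0" using V01[of y] False that by (simp add: I_def indicator_def)
      ultimately show ?thesis by (simp add: mult_nonpos_nonpos)
    qed
    fix y :: real
    have Is: "I (- y) = I y" by (simp add: I_def indicator_def)
    consider "y > 0" | "y < 0" | "y = 0" by linarith
    then show "0 \<le> normal_density \<mu> 1 y * ((sg y - a) * I y) - normal_density \<mu> 1 y * ((sg y - a) * V y)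
       + (normal_density \<mu> 1 (- y) * ((sg (- y) - a) * I (- y)) - normal_density \<mu> 1 (- y) * ((sg (- y) - a) * V (- y)))"
      (is "0 \<le> ?R")
    proof cases
      case 1
      have "?R = (I y - V y) * E y"
        using 1 unfolding Is even E_def sg_def by (simp add: algebra_simps)
      then show ?thesis using pos[OF 1] by simp
    next
      case 2
      have "?R = (I (- y) - V (- y)) * E (- y)"
        using 2 unfolding Is even E_def sg_def by (simp add: algebra_simps)
      then show ?thesis using pos[of "- y"] 2 by simp
    next
      \<comment> \<open>The point \<open>0\<close> is its own mirror image, and there
        \<open>sg\<close> is \<open>- 1\<close>; the weight \<open>I\<close> vanishes, so what
        remains is a nonnegative multiple of \<open>(1 + a) * V 0\<close>.\<close>
      case 3
      have "I 0 = 0" using \<open>0 \<le> r0\<close> by (simp add: I_def indicator_def)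
      moreover have "1 + a \<ge> 0" unfolding a1 by simp
      ultimately show ?thesis using 3 V01[of 0] unfolding sg_def
        by (simp add: mult_nonneg_nonpos mult_nonneg_nonneg)
    qed
  qed
  also have "\<dots> = (\<integral>y. (sg y - a) * I y \<partial>gauss \<mu>) - (\<integral>y. (sg y - a) * V y \<partial>gauss \<mu>)"
    using int I01 V01 by (subst Bochner_Integration.integral_diff) (auto simp: integral_gauss)
  finally show ?thesis by (simp add: I_def)
qed

subsection \<open>Ranks and order statistics\<close>

text \<open>Common generalization of \<open>absrank\<close> (with \<open>f\<close> the negated
  absolute value) and \<open>grank\<close> (with \<open>f\<close> the \<open>gfun\<close> of the
  p-value), so that facts on ranks are proved once for both.\<close>

definition lexrank :: "nat \<Rightarrow> (nat \<Rightarrow> real) \<Rightarrow> nat \<Rightarrow> nat" where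
  "lexrank n f i = card {l. l < n \<and> (f l < f i \<or> (f l = f i \<and> l < i))}"

lemma absrank_eq_lexrank: "absrank N x = lexrank N (\<lambda>l. - \<bar>x l\<bar>)"
  by (auto simp: absrank_def lexrank_def fun_eq_iff intro!: arg_cong[where f = card])

lemma grank_eq_lexrank: "grank n Z = lexrank n (\<lambda>l. gfun (pval Z l))"
  by (auto simp: grank_def lexrank_def fun_eq_iff)

lemma lexrank_less:
  assumes "i < n" "f i < f k \<or> (f i = f k \<and> i < k)"
  shows "lexrank n f i < lexrank n f k"
  unfolding lexrank_def by (rule psubset_card_mono) (use assms in auto)

text \<open>Breaking ties by index makes the order strict and total, so ranks are injective, and an
  injective map of a finite set into itself is onto.\<close>

lemma lexrank_bij: "bij_betw (lexrank n f) {..<n} {..<n}"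
proof -
  have "inj_on (lexrank n f) {..<n}"
  proof (rule inj_onI)
    fix i k assume ik: "i \<in> {..<n}" "k \<in> {..<n}" "lexrank n f i = lexrank n f k"
    then show "i = k"
      using lexrank_less[of i n f k] lexrank_less[of k n f i] by fastforce
  qed
  moreover have "lexrank n f i < n" if "i < n" for i
  proof -
    have "lexrank n f i < card {..<n}"
      unfolding lexrank_def by (rule psubset_card_mono) (use that in auto)
    then show ?thesis by simp
  qed
  ultimately show ?thesis
    by (intro bij_betw_imageI endo_inj_surj) auto
qed

text \<open>A strict sublevel set of \<open>f\<close> is an initial segment of the order, ties
  included. This is what makes the hypotheses above a threshold one of the sets
  \<open>Mset\<close>.\<close>

lemma lexrank_less_card_iff:
  assumes "i < n"
  shows "lexrank n f i < card {l. l < n \<and> f l < c} \<longleftrightarrow> f i < c"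
proof
  assume *: "lexrank n f i < card {l. l < n \<and> f l < c}"
  show "f i < c"
  proof (rule ccontr)
    assume "\<not> f i < c"
    then have "card {l. l < n \<and> f l < c} \<le> lexrank n f i"
      unfolding lexrank_def by (intro card_mono) auto
    with * show False by simp
  qed
next
  assume "f i < c"
  then show "lexrank n f i < card {l. l < n \<and> f l < c}"
    unfolding lexrank_def using assms by (intro psubset_card_mono) auto
qed

lemma sum_lexrank:
  assumes "j \<le> n"
  shows "(\<Sum>i<n. if lexrank n f i < j then 1 else 0 :: real) = real j"
proof -
  have "(\<Sum>i<n. if lexrank n f i < j then 1 else 0 :: real) = (\<Sum>i<n. if i < j then 1 else 0)"
    using sum.reindex_bij_betw[OF lexrank_bij[of n f], of "\<lambda>i. if i < j then 1 else 0 :: real"] by simp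
  also have "\<dots> = (\<Sum>i\<in>{..<n} \<inter> {..<j}. 1)"
    by (subst sum.inter_restrict) auto
  also have "{..<n} \<inter> {..<j} = {..<j}" using assms by auto
  finally show ?thesis by simp
qed

lemma ord_stat_absrank:
  assumes "i < N" "absrank N x i = s - 1"
  shows "ord_stat N x s = x i"
proof -
  have inj: "inj_on (absrank N x) {..<N}"
    unfolding absrank_eq_lexrank using lexrank_bij bij_betw_def by blast
  have "ord_stat N x s = (\<Sum>l<N. if l = i then x l else 0)"
    unfolding ord_stat_def using assms inj
    by (intro sum.cong) (auto simp: inj_on_def)
  then show ?thesis using assms by simp
qed

lemma absrank_surj:
  assumes "1 \<le> s" "s \<le> N"
  obtains i where "i < N" "absrank N x i = s - 1"
proof -
  have "s - 1 \<in> absrank N x ` {..<N}"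
    unfolding absrank_eq_lexrank
    using lexrank_bij[of N "\<lambda>l. - \<bar>x l\<bar>"] assms by (simp add: bij_betw_def)
  then show ?thesis using that by auto
qed

text \<open>Passes from ordered positions to coordinates along the rank bijection, so that
  expectations can be taken one coordinate at a time.\<close>

lemma sum_ord_stat:
  fixes h :: "real \<Rightarrow> real"
  assumes "j \<le> N"
  shows "(\<Sum>s=1..j. h (ord_stat N x s)) = (\<Sum>i<N. h (x i) * (if absrank N x i < j then 1 else 0))"
proof -
  have bij: "bij_betw (absrank N x) {..<N} {..<N}"
    unfolding absrank_eq_lexrank by (rule lexrank_bij)
  \<comment> \<open>Order statistics are numbered from \<open>1\<close>, ranks from
    \<open>0\<close>.\<close>
  have "(\<Sum>s=1..j. h (ord_stat N x s)) = (\<Sum>s<j. h (ord_stat N x (Suc s)))"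
    by (rule sum.reindex_bij_witness[of _ Suc "\<lambda>s. s - 1"]) auto
  also have "\<dots> = (\<Sum>s\<in>{..<N} \<inter> {..<j}. h (ord_stat N x (Suc s)))"
    using assms by (intro sum.cong) auto
  also have "\<dots> = (\<Sum>s<N. if s < j then h (ord_stat N x (Suc s)) else 0)"
    by (subst sum.inter_restrict) auto
  also have "\<dots> = (\<Sum>i<N. if absrank N x i < j then h (ord_stat N x (Suc (absrank N x i))) else 0)"
    by (rule sum.reindex_bij_betw[OF bij, symmetric])
  also have "\<dots> = (\<Sum>i<N. h (x i) * (if absrank N x i < j then 1 else 0))"
    by (intro sum.cong) (auto simp: ord_stat_absrank)
  finally show ?thesis .
qed

text \<open>If the \<open>j\<close>-th order statistic exceeded \<open>z\<close> in absolute value,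
  so would the coordinate it comes from and the \<open>j - 1\<close> ranked before it, which makes
  \<open>j\<close> in all.\<close>

lemma abs_ord_stat_le:
  assumes "1 \<le> j" "j \<le> N" "card {l. l < N \<and> \<bar>x l\<bar> > \<bar>z\<bar>} < j"
  shows "\<bar>ord_stat N x j\<bar> \<le> \<bar>z\<bar>"
proof (rule ccontr)
  assume *: "\<not> \<bar>ord_stat N x j\<bar> \<le> \<bar>z\<bar>"
  obtain i where i: "i < N" "absrank N x i = j - 1"
    using absrank_surj assms by blast
  have "insert i {l. l < N \<and> (\<bar>x l\<bar> > \<bar>x i\<bar> \<or> (\<bar>x l\<bar> = \<bar>x i\<bar> \<and> l < i))} \<subseteq> {l. l < N \<and> \<bar>x l\<bar> > \<bar>z\<bar>}"
    using i * ord_stat_absrank[OF i] by auto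
  then have "card (insert i {l. l < N \<and> (\<bar>x l\<bar> > \<bar>x i\<bar> \<or> (\<bar>x l\<bar> = \<bar>x i\<bar> \<and> l < i))}) \<le> card {l. l < N \<and> \<bar>x l\<bar> > \<bar>z\<bar>}"
    by (intro card_mono) auto
  then show False using assms i by (simp add: absrank_def)
qed

subsection \<open>The binomial quantile\<close>

lemma binomial_pmf_exp:
  assumes "0 \<le> p" "p \<le> 1"
  shows "measure_pmf.expectation (binomial_pmf N p) (\<lambda>k. exp (- s * real k)) = (1 - p + p * exp (- s)) ^ N"
proof -
  have "measure_pmf.expectation (binomial_pmf N p) (\<lambda>k. exp (- s * real k))
      = (\<Sum>k\<le>N. pmf (binomial_pmf N p) k * exp (- s * real k))"
    by (subst integral_measure_pmf[of "{..N}"]) (auto simp: set_pmf_binomial_eq assms split: if_splits)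
  also have "\<dots> = (\<Sum>k\<le>N. real (N choose k) * (p * exp (- s)) ^ k * (1 - p) ^ (N - k))"
  proof (intro sum.cong refl)
    fix k
    have "exp (- s * real k) = exp (- s) ^ k" by (simp add: exp_of_nat_mult[symmetric] mult.commute)
    then show "pmf (binomial_pmf N p) k * exp (- s * real k)
        = real (N choose k) * (p * exp (- s)) ^ k * (1 - p) ^ (N - k)"
      using assms by (simp add: power_mult_distrib)
  qed
  also have "\<dots> = (1 - p + p * exp (- s)) ^ N"
    by (subst add.commute, subst binomial_ring) simp
  finally show ?thesis .
qed

text \<open>The tail beyond \<open>N\<close> is empty, so some \<open>t\<close> qualifies and
  \<open>LEAST\<close> picks one that does. For a discrete law only \<open>\<le>\<close> can be
  expected.\<close>

lemma binom_upper_quantile_prob: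
  assumes "0 \<le> p" "p \<le> 1" "0 \<le> \<gamma>"
  shows "measure_pmf.prob (binomial_pmf N p) {binom_upper_quantile \<gamma> N p..} \<le> \<gamma>"
proof -
  have "measure_pmf.prob (binomial_pmf N p) {Suc N..} = 0"
    by (subst measure_pmf_zero_iff) (auto simp: set_pmf_binomial_eq assms split: if_splits)
  then have "measure_pmf.prob (binomial_pmf N p) {Suc N..} \<le> \<gamma>" using assms by simp
  then show ?thesis unfolding binom_upper_quantile_def by (rule LeastI)
qed

text \<open>A lower-tail Chernoff bound read backwards: a count below the quantile has probability
  at least \<open>1 - \<gamma>\<close>, while the exponential Markov inequality makes that
  probability small when the mean is large. So the mean cannot be far above the quantile.\<close>

lemma binomial_mean_le_quantile:
  assumes p: "0 \<le> p" "p \<le> 1" and \<gamma>: "0 \<le> \<gamma>" "\<gamma> \<le> 1 / 2" and "s > 0"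
  shows "real N * p * (1 - exp (- s)) \<le> s * (real (binom_upper_quantile \<gamma> N p) - 1) + 2 * \<gamma>"
proof -
  define t where "t = binom_upper_quantile \<gamma> N p"
  define B where "B = binomial_pmf N p"
  have t: "measure_pmf.prob B {t..} \<le> \<gamma>"
    using binom_upper_quantile_prob[of p \<gamma> N] p \<gamma> by (simp add: t_def B_def)
  have "{..<t} = UNIV - {t..}" by auto
  then have "1 - \<gamma> \<le> measure_pmf.prob B {..<t}"
    using measure_pmf.prob_compl[of "{t..}" B] t by simp
  also have "\<dots> = measure_pmf.expectation B (indicator {..<t})" by simp
  also have "\<dots> \<le> measure_pmf.expectation B (\<lambda>k. exp (s * (real t - 1)) * exp (- s * real k))"
  proof (rule integral_mono)
    show "integrable B (indicator {..<t} :: nat \<Rightarrow> real)"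
      by (rule integrable_measure_pmf_finite) (auto simp: B_def set_pmf_binomial_eq p split: if_splits)
    show "integrable B (\<lambda>k. exp (s * (real t - 1)) * exp (- s * real k))"
      by (rule integrable_measure_pmf_finite) (auto simp: B_def set_pmf_binomial_eq p split: if_splits)
    fix k
    \<comment> \<open>Integrality: \<open>k < t\<close> means \<open>k \<le> t - 1\<close>. The unit
      gained here later pays for the term \<open>2 * \<gamma>\<close>.\<close>
    have "1 \<le> exp (s * (real t - 1 - real k))" if "k < t"
      using that \<open>s > 0\<close> by (intro one_le_exp_iff[THEN iffD2] mult_nonneg_nonneg) auto
    then show "indicator {..<t} k \<le> exp (s * (real t - 1)) * exp (- s * real k)"
      by (auto simp: indicator_def exp_add[symmetric] algebra_simps)
  qed
  also have "\<dots> = exp (s * (real t - 1)) * (1 - p + p * exp (- s)) ^ N"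
    using binomial_pmf_exp[OF p] by (simp add: B_def)
  also have "\<dots> \<le> exp (s * (real t - 1)) * exp (- (real N * p * (1 - exp (- s))))"
  proof (intro mult_left_mono)
    have "1 - p + p * exp (- s) \<le> exp (- (p * (1 - exp (- s))))"
      using exp_ge_add_one_self[of "- (p * (1 - exp (- s)))"] by (simp add: algebra_simps)
    then have "(1 - p + p * exp (- s)) ^ N \<le> exp (- (p * (1 - exp (- s)))) ^ N"
      using p by (intro power_mono) auto
    then show "(1 - p + p * exp (- s)) ^ N \<le> exp (- (real N * p * (1 - exp (- s))))"
      by (simp add: exp_of_nat_mult[symmetric] mult.assoc)
  qed simp
  also have "\<dots> = exp (s * (real t - 1) - real N * p * (1 - exp (- s)))"
    by (simp add: exp_add[symmetric])
  finally have 1: "1 - \<gamma> \<le> exp (s * (real t - 1) - real N * p * (1 - exp (- s)))" .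
  \<comment> \<open>This replaces \<open>1 - \<gamma>\<close> by
    \<open>exp (- (2 * \<gamma>))\<close>, so that exponents can be compared; it rests on
    \<open>\<gamma> \<le> 1 / 2\<close>.\<close>
  have "exp (2 * \<gamma>) * (1 - \<gamma>) \<ge> (1 + 2 * \<gamma>) * (1 - \<gamma>)"
    using \<gamma> exp_ge_add_one_self[of "2 * \<gamma>"] by (intro mult_right_mono) auto
  moreover have "(1 + 2 * \<gamma>) * (1 - \<gamma>) \<ge> 1"
    using mult_nonneg_nonneg[of \<gamma> "1 - 2 * \<gamma>"] \<gamma> by (simp add: algebra_simps)
  ultimately have "1 / exp (2 * \<gamma>) \<le> 1 - \<gamma>" by (simp add: field_simps)
  then have "exp (- (2 * \<gamma>)) \<le> 1 - \<gamma>" by (simp add: exp_minus field_simps)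
  with 1 have "exp (- (2 * \<gamma>)) \<le> exp (s * (real t - 1) - real N * p * (1 - exp (- s)))" by linarith
  then show ?thesis by (simp add: t_def)
qed

subsection \<open>Real inequalities\<close>

lemma le_of_deriv_le:
  fixes f g :: "real \<Rightarrow> real"
  assumes "f 0 \<le> g 0" "0 \<le> x"
    and "\<And>y. (f has_real_derivative f' y) (at y)" "\<And>y. (g has_real_derivative g' y) (at y)"
    and "\<And>y. 0 \<le> y \<Longrightarrow> y \<le> x \<Longrightarrow> f' y \<le> g' y"
  shows "f x \<le> g x"
proof -
  have "g 0 - f 0 \<le> g x - f x"
  proof (rule DERIV_nonneg_imp_nondecreasing[OF assms(2)])
    fix y assume "0 \<le> y" "y \<le> x"
    then show "\<exists>d. ((\<lambda>y. g y - f y) has_real_derivative d) (at y) \<and> 0 \<le> d"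
      using assms(5)[of y] DERIV_diff[OF assms(4,3), of y] by auto
  qed
  with assms(1) show ?thesis by simp
qed

lemma sinh_ge_cubic:
  fixes x :: real
  assumes "0 \<le> x"
  shows "x + x ^ 3 / 6 \<le> sinh x"
proof -
  have 1: "y \<le> sinh y" if "0 \<le> y" for y :: real
    by (rule le_of_deriv_le[OF _ that, where f' = "\<lambda>_. 1" and g' = cosh])
       (auto intro!: derivative_eq_intros simp: cosh_real_ge_1)
  have 2: "1 + y\<^sup>2 / 2 \<le> cosh y" if "0 \<le> y" for y :: real
    by (rule le_of_deriv_le[OF _ that, where f' = "\<lambda>y. y" and g' = sinh])
       (auto intro!: derivative_eq_intros 1)
  show ?thesis
    by (rule le_of_deriv_le[OF _ assms, where f' = "\<lambda>y. 1 + y\<^sup>2 / 2" and g' = cosh])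
       (auto intro!: derivative_eq_intros 2)
qed

text \<open>Start from the crude bound \<open>4\<close> on \<open>[0, 1]\<close> and integrate four
  times; the resulting constant \<open>4 / 24\<close> equals the cubic coefficient in
  \<open>sinh_ge_cubic\<close>, against which it cancels later.\<close>

lemma cosh_le_quartic:
  fixes x :: real
  assumes "0 \<le> x" "x \<le> 1"
  shows "cosh x \<le> 1 + x\<^sup>2 / 2 + x ^ 4 / 6"
proof -
  have c: "cosh y \<le> 4" if "0 \<le> y" "y \<le> 1" for y :: real
  proof -
    have "exp y \<le> 3" "exp (- y) \<le> 3"
      using that by (auto intro!: order_trans[OF _ exp_le])
    then have "exp y + exp (- y) \<le> 3 + 3" by (rule add_mono)
    then show ?thesis by (simp add: cosh_field_def)
  qed
  have 1: "sinh y \<le> 4 * y" if "0 \<le> y" "y \<le> 1" for y :: real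
    by (rule le_of_deriv_le[OF _ that(1), where g' = "\<lambda>_. 4" and f' = cosh])
       (use that in \<open>auto intro!: derivative_eq_intros c\<close>)
  have 2: "cosh y \<le> 1 + 2 * y\<^sup>2" if "0 \<le> y" "y \<le> 1" for y :: real
    by (rule le_of_deriv_le[OF _ that(1), where g' = "\<lambda>y. 4 * y" and f' = sinh])
       (use that in \<open>auto intro!: derivative_eq_intros 1\<close>)
  have 3: "sinh y \<le> y + 2 * y ^ 3 / 3" if "0 \<le> y" "y \<le> 1" for y :: real
    by (rule le_of_deriv_le[OF _ that(1), where g' = "\<lambda>y. 1 + 2 * y\<^sup>2" and f' = cosh])
       (use that in \<open>auto intro!: derivative_eq_intros 2\<close>)
  show ?thesis
    by (rule le_of_deriv_le[OF _ assms(1), where g' = "\<lambda>y. y + 2 * y ^ 3 / 3" and f' = sinh])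
       (use assms in \<open>auto intro!: derivative_eq_intros 3\<close>)
qed

text \<open>The quartic term of \<open>cosh \<theta>\<close> cancels against
  \<open>\<theta> ^ 3 / 6 * \<theta>\<close> in the product with \<open>sinh \<theta>\<close>, and
  \<open>exp (\<theta> * c)\<close> is at most \<open>1 / (1 - \<theta> * c)\<close>. The first
  bound controls the main part of the Chernoff exponent, the second the cost of an excess in the
  null count.\<close>

lemma chernoff_exponent_le:
  fixes \<theta> c :: real
  assumes "0 \<le> \<theta>" "0 \<le> c" "2 * c + \<theta> \<le> 1"
  shows "exp (\<theta> * c) * (cosh \<theta> - sinh \<theta> * (2 * c + \<theta>)) \<le> 1 - \<theta> * c - \<theta>\<^sup>2 / 2"
    and "exp (\<theta> * c) * cosh \<theta> - 1 \<le> \<theta> * (2 * c + \<theta>)"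
proof -
  have \<theta>1: "\<theta> \<le> 1" using assms by simp
  define x where "x = \<theta> * c"
  have x0: "0 \<le> x" using assms by (simp add: x_def)
  have xy: "\<theta> * (2 * c + \<theta>) = 2 * x + \<theta>\<^sup>2" by (simp add: x_def power2_eq_square algebra_simps)
  have "\<theta> * (2 * c + \<theta>) \<le> 1 * 1" using assms \<theta>1 by (intro mult_mono) auto
  then have x1: "2 * x + \<theta>\<^sup>2 \<le> 1" using xy by simp
  have x2: "0 < 1 - x"
  proof -
    have "0 \<le> \<theta>\<^sup>2" by simp
    then show ?thesis using x0 x1 by linarith
  qed
  have E: "exp x \<le> 1 / (1 - x)"
  proof -
    have "1 - x \<le> exp (- x)" using exp_ge_add_one_self[of "- x"] by simp
    then have "inverse (exp (- x)) \<le> inverse (1 - x)" using x2 by (rule le_imp_inverse_le)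
    then show ?thesis by (simp add: exp_minus inverse_eq_divide)
  qed
  have c1: "cosh \<theta> \<le> 1 + \<theta>\<^sup>2 / 2 + \<theta> ^ 4 / 6"
    using cosh_le_quartic assms(1) \<theta>1 by blast
  have s1: "sinh \<theta> \<ge> \<theta> + \<theta> ^ 3 / 6"
    using sinh_ge_cubic assms(1) by blast
  have "sinh \<theta> * (2 * c + \<theta>) \<ge> (\<theta> + \<theta> ^ 3 / 6) * (2 * c + \<theta>)"
    using s1 assms by (intro mult_right_mono) auto
  moreover have "(\<theta> + \<theta> ^ 3 / 6) * (2 * c + \<theta>) = 2 * x + \<theta>\<^sup>2 + \<theta>\<^sup>2 * x / 3 + \<theta> ^ 4 / 6"
    by (simp add: x_def power2_eq_square power3_eq_cube power4_eq_xxxx algebra_simps)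
  moreover have "\<theta>\<^sup>2 * x / 3 \<ge> 0" using x0 by simp
  ultimately have "cosh \<theta> - sinh \<theta> * (2 * c + \<theta>) \<le> 1 - \<theta>\<^sup>2 / 2 - 2 * x"
    using c1 by linarith
  then have "exp x * (cosh \<theta> - sinh \<theta> * (2 * c + \<theta>)) \<le> exp x * (1 - \<theta>\<^sup>2 / 2 - 2 * x)"
    by (intro mult_left_mono) auto
  also have "\<dots> \<le> 1 / (1 - x) * (1 - \<theta>\<^sup>2 / 2 - 2 * x)"
  proof (intro mult_right_mono E)
    have "\<theta>\<^sup>2 / 2 \<le> \<theta>\<^sup>2" by simp
    then show "0 \<le> 1 - \<theta>\<^sup>2 / 2 - 2 * x" using x1 by linarith
  qed
  also have "\<dots> \<le> 1 - x - \<theta>\<^sup>2 / 2"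
  proof -
    have "1 - \<theta>\<^sup>2 / 2 - 2 * x \<le> (1 - x - \<theta>\<^sup>2 / 2) * (1 - x)"
      using x0 by (simp add: algebra_simps)
    then show ?thesis using x2 by (simp add: pos_divide_le_eq)
  qed
  finally show "exp (\<theta> * c) * (cosh \<theta> - sinh \<theta> * (2 * c + \<theta>)) \<le> 1 - \<theta> * c - \<theta>\<^sup>2 / 2"
    by (simp add: x_def)
  have "exp x * cosh \<theta> \<le> 1 / (1 - x) * (1 + \<theta>\<^sup>2 / 2 + \<theta> ^ 4 / 6)"
    using E c1 x1 x0 zero_le_power2[of \<theta>] less_imp_le[OF x2] by (intro mult_mono) simp_all
  also have "\<dots> \<le> 1 + 2 * x + \<theta>\<^sup>2"
  proof -
    have "\<theta> ^ 4 \<le> \<theta>\<^sup>2" using \<theta>1 assms by (intro power_decreasing) auto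
    moreover have "1 + \<theta>\<^sup>2 * (2 / 3) \<le> (1 + 2 * x + \<theta>\<^sup>2) * (1 - x)"
    proof -
      \<comment> \<open>The constraint allows \<open>c\<close> at most
        \<open>(1 - \<theta>) / 2\<close>, hence \<open>\<theta> * c \<le> 1 / 8\<close>; the
        products with \<open>x\<close> then become small enough for linear arithmetic.\<close>
      have "c \<le> 1 / 2 - \<theta> / 2" using assms by simp
      then have "\<theta> * c \<le> \<theta> * (1 / 2 - \<theta> / 2)" using assms by (intro mult_left_mono) auto
      moreover have "\<theta> * (1 / 2 - \<theta> / 2) \<le> 1 / 8"
        using zero_le_power2[of "\<theta> - 1 / 2"] by (simp add: power2_eq_square algebra_simps)
      ultimately have "x \<le> 1 / 8" by (simp add: x_def)
      then have "x * x \<le> 1 / 8 * x" "x * \<theta>\<^sup>2 \<le> 1 / 8 * \<theta>\<^sup>2" using x0 by (intro mult_right_mono; simp)+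
      moreover have "0 \<le> \<theta>\<^sup>2" by simp
      moreover have "(1 + 2 * x + \<theta>\<^sup>2) * (1 - x) = 1 + x + \<theta>\<^sup>2 - 2 * (x * x) - x * \<theta>\<^sup>2"
        by (simp add: algebra_simps)
      ultimately show ?thesis using x0 by linarith
    qed
    ultimately have "1 + \<theta>\<^sup>2 / 2 + \<theta> ^ 4 / 6 \<le> (1 + 2 * x + \<theta>\<^sup>2) * (1 - x)" by linarith
    then show ?thesis using x2 by (simp add: pos_divide_le_eq)
  qed
  finally show "exp (\<theta> * c) * cosh \<theta> - 1 \<le> \<theta> * (2 * c + \<theta>)"
    unfolding xy by (simp add: x_def)
qed

section \<open>Bounds on the boundary constant\<close>

lemma Cconst_bounds:
  assumes "1 \<le> n" "0 < \<gamma>" "\<gamma> \<le> 1"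
  shows "0 < Cconst n \<gamma>"
    and "(Cconst n \<gamma>)\<^sup>2 \<ge> 2.89 * (0.72 * ln (5.2 / \<gamma>) - 1 / 2)"
    and "1 \<le> k \<Longrightarrow> k \<le> n \<Longrightarrow> Cconst k \<gamma> \<le> Cconst n \<gamma>"
proof -
  have ln2: "ln (2 * real m) \<ge> 2 / 3" if "1 \<le> m" for m
  proof -
    have "ln 2 \<le> ln (2 * real m)" using that by simp
    then show ?thesis using ln2_ge_two_thirds by linarith
  qed
  \<comment> \<open>The iterated logarithm is negative at \<open>m = 1\<close>; the bound comes from
    \<open>ln 2 \<ge> 2 / 3 \<ge> exp (- (1 / 2))\<close>.\<close>
  have lnln: "ln (ln (2 * real m)) \<ge> - (1 / 2)" if "1 \<le> m" for m
  proof -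
    have "exp (- (1 / 2)) \<le> (2 / 3 :: real)"
      using exp_ge_add_one_self[of "1 / 2"] by (simp add: exp_minus field_simps)
    also have "\<dots> \<le> ln (2 * real m)" using ln2[OF that] .
    finally have "ln (exp (- (1 / 2))) \<le> ln (ln (2 * real m))"
      by (subst ln_le_cancel_iff) (use ln2[OF that] in auto)
    then show ?thesis by simp
  qed
  \<comment> \<open>Since \<open>5.2\<close> exceeds \<open>exp 1\<close>, the second summand under
    the root is at least \<open>0.72\<close>, which outweighs the \<open>- (1 / 2)\<close>.\<close>
  have "exp 1 \<le> (5.2 :: real)" using exp_le by simp
  also have "(5.2 :: real) \<le> 5.2 / \<gamma>" using assms by (simp add: field_simps)
  finally have "ln (exp 1) \<le> ln (5.2 / \<gamma>)"
    by (subst ln_le_cancel_iff) (use assms in auto)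
  then have l: "1 \<le> ln (5.2 / \<gamma>)" by simp
  have pos: "ln (ln (2 * real m)) + 0.72 * ln (5.2 / \<gamma>) > 0" if "1 \<le> m" for m
    using lnln[OF that] l by simp
  then show "0 < Cconst n \<gamma>" using assms by (simp add: Cconst_def)
  have "(Cconst n \<gamma>)\<^sup>2 = 2.89 * (ln (ln (2 * real n)) + 0.72 * ln (5.2 / \<gamma>))"
    using pos[OF assms(1)] by (simp add: Cconst_def power_mult_distrib) (simp add: power2_eq_square)
  then show "(Cconst n \<gamma>)\<^sup>2 \<ge> 2.89 * (0.72 * ln (5.2 / \<gamma>) - 1 / 2)"
    using lnln[OF assms(1)] by simp
  assume k: "1 \<le> k" "k \<le> n"
  have "ln (2 * real k) \<le> ln (2 * real n)" using k by simp
  then have "ln (ln (2 * real k)) \<le> ln (ln (2 * real n))"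
    using ln2[OF k(1)] by (subst ln_le_cancel_iff) auto
  then show "Cconst k \<gamma> \<le> Cconst n \<gamma>" by (simp add: Cconst_def)
qed

text \<open>Half of the square grows with slope \<open>2.89 * 0.72 / 2 > 1\<close> in
  \<open>- ln \<beta>\<close>, which yields the factor \<open>\<beta>\<close>. The rest, with
  \<open>ln 10.4 \<ge> 2\<close>, is at least \<open>2.08\<close>, more than \<open>5 / 4\<close>
  and the loss \<open>2.89 / 4\<close> together.\<close>

lemma Cconst_exp_le:
  assumes "1 \<le> n" "0 < \<beta>" "\<beta> < 1"
  shows "exp (5 / 4 - (Cconst n (\<beta> / 2))\<^sup>2 / 2) \<le> \<beta>"
proof -
  have "exp 2 \<le> (10.4 :: real)"
  proof -
    have "exp 2 = (exp 1 :: real)\<^sup>2" by (simp add: exp_of_nat_mult[symmetric] power2_eq_square exp_add[symmetric])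
    also have "\<dots> \<le> 3\<^sup>2" using exp_le by (intro power_mono) auto
    finally show ?thesis by simp
  qed
  then have "ln (exp 2) \<le> ln (10.4 :: real)" by (subst ln_le_cancel_iff) auto
  then have 1: "2 \<le> ln (10.4 :: real)" by simp
  have "5.2 / (\<beta> / 2) = 10.4 / \<beta>" by simp
  then have 2: "ln (5.2 / (\<beta> / 2)) = ln 10.4 - ln \<beta>"
    using assms by (simp only: ln_div) (simp add: ln_div)
  have 3: "ln \<beta> \<le> 0" using assms by simp
  have "(Cconst n (\<beta> / 2))\<^sup>2 \<ge> 2.89 * (0.72 * (ln 10.4 - ln \<beta>) - 1 / 2)"
    using Cconst_bounds(2)[of n "\<beta> / 2"] assms unfolding 2 by auto
  then have "5 / 4 - (Cconst n (\<beta> / 2))\<^sup>2 / 2 \<le> ln \<beta>"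
    using 1 3 by (simp add: field_simps)
  then have "exp (5 / 4 - (Cconst n (\<beta> / 2))\<^sup>2 / 2) \<le> exp (ln \<beta>)" by simp
  then show ?thesis using assms by simp
qed

subsection \<open>Order statistics of the non-nulls\<close>

lemma iid_gauss_prob_space: "prob_space (iid_gauss N \<mu>)"
  unfolding iid_gauss_def by (intro prob_space_PiM prob_space_gauss)

lemma iid_gauss_component [measurable]:
  assumes "i < N" shows "(\<lambda>x. x i) \<in> borel_measurable (iid_gauss N \<mu>)"
proof -
  have "(\<lambda>x. x i) \<in> measurable (iid_gauss N \<mu>) (gauss \<mu>)"
    unfolding iid_gauss_def using assms by (intro measurable_component_singleton) simp
  moreover have "measurable (iid_gauss N \<mu>) (gauss \<mu>) = borel_measurable (iid_gauss N \<mu>)"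
    by (rule measurable_cong_sets) simp_all
  ultimately show ?thesis by simp
qed

lemma lexrank_measurable:
  assumes [measurable]: "\<And>i. i < n \<Longrightarrow> (\<lambda>x. f x i) \<in> borel_measurable M" and "i < n"
  shows "(\<lambda>x. lexrank n (f x) i) \<in> measurable M (count_space UNIV)"
  unfolding lexrank_def
proof (rule measurable_card)
  fix l
  have [measurable]: "(\<lambda>x. f x i) \<in> borel_measurable M" using assms by simp
  show "{x \<in> space M. l \<in> {l. l < n \<and> (f x l < f x i \<or> f x l = f x i \<and> l < i)}} \<in> sets M"
    by (cases "l < n") auto
qed

lemma absrank_measurable [measurable]:
  "i < n \<Longrightarrow> (\<lambda>x. absrank n x i) \<in> measurable (iid_gauss n \<mu>) (count_space UNIV)"
  unfolding absrank_eq_lexrank by (rule lexrank_measurable) auto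

lemma ord_stat_measurable [measurable]:
  "(\<lambda>x. ord_stat n x s) \<in> borel_measurable (iid_gauss n \<mu>)"
  unfolding ord_stat_def by (intro borel_measurable_sum) auto

text \<open>Exactly \<open>j\<close> coordinates are selected, so subtracting \<open>a\<close> from
  each sign costs only \<open>real j * a\<close>. With the other coordinates fixed, being selected
  is an even event in the remaining one, so \<open>gauss_threshold_optimal\<close> bounds its
  contribution by that of the fixed threshold \<open>r0\<close>.\<close>

lemma expected_top_signs_le:
  assumes "j \<le> N" "\<mu> > 0" "0 \<le> r0"
  defines "a \<equiv> tanh (\<mu> * r0)"
  shows "(\<Sum>s=1..j. 2 * measure (iid_gauss N \<mu>) {x \<in> space (iid_gauss N \<mu>). ord_stat N x s > 0} - 1)
    \<le> real j * a + real N * (\<integral>y. (sg y - a) * indicator {y. \<bar>y\<bar> > r0} y \<partial>gauss \<mu>)"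
proof -
  interpret P: prob_space "iid_gauss N \<mu>" by (rule iid_gauss_prob_space)
  interpret PS: product_sigma_finite "\<lambda>_::nat. gauss \<mu>" ..
  define T :: "(nat \<Rightarrow> real) \<Rightarrow> nat \<Rightarrow> real" where "T x i = (if absrank N x i < j then 1 else 0)" for x i
  have T01: "0 \<le> T x i" "T x i \<le> 1" for x i by (auto simp: T_def)
  have T_meas [measurable]: "(\<lambda>x. T x i) \<in> borel_measurable (iid_gauss N \<mu>)" if "i < N" for i
    unfolding T_def using that by measurable
  define J where "J = (\<integral>y. (sg y - a) * indicator {y. \<bar>y\<bar> > r0} y \<partial>gauss \<mu>)"
  have bd: "\<bar>(sg z - a) * T x i\<bar> \<le> 1 + \<bar>a\<bar>" for z x i
  proof -
    have "\<bar>sg z - a\<bar> * \<bar>T x i\<bar> \<le> (1 + \<bar>a\<bar>) * 1"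
      using T01[of x i] by (intro mult_mono) (auto simp: sg_def)
    then show ?thesis by (simp add: abs_mult)
  qed
  have int: "integrable (iid_gauss N \<mu>) (\<lambda>x. (sg (x i) - a) * T x i)" if "i < N" for i
  proof (rule P.integrable_const_bound)
    show "AE x in iid_gauss N \<mu>. norm ((sg (x i) - a) * T x i) \<le> 1 + \<bar>a\<bar>" using bd by simp
    show "(\<lambda>x. (sg (x i) - a) * T x i) \<in> borel_measurable (iid_gauss N \<mu>)"
      using iid_gauss_component[OF that] T_meas[OF that] by measurable
  qed
  have each: "(\<integral>x. (sg (x i) - a) * T x i \<partial>iid_gauss N \<mu>) \<le> J" if i: "i < N" for i
  proof -
    define I where "I = {..<N} - {i}"
    have I: "finite I" "i \<notin> I" "insert i I = {..<N}" using i by (auto simp: I_def)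
    interpret Q: prob_space "PiM I (\<lambda>_. gauss \<mu>)" by (intro prob_space_PiM prob_space_gauss)
    have "(\<integral>x. (sg (x i) - a) * T x i \<partial>iid_gauss N \<mu>)
        = (\<integral>x. (\<integral>y. (sg y - a) * T (x(i := y)) i \<partial>gauss \<mu>) \<partial>PiM I (\<lambda>_. gauss \<mu>))"
      using PS.product_integral_insert[OF I(1,2), of "\<lambda>x. (sg (x i) - a) * T x i"] int[OF i]
      unfolding I(3) iid_gauss_def by simp
    also have "\<dots> \<le> (\<integral>x. J \<partial>PiM I (\<lambda>_. gauss \<mu>))"
    proof (rule integral_mono')
      fix x assume x: "x \<in> space (PiM I (\<lambda>_. gauss \<mu>))"
      have upd: "(\<lambda>y. x(i := y)) \<in> measurable borel (iid_gauss N \<mu>)"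
        unfolding iid_gauss_def I(3)[symmetric]
        by (rule measurable_fun_upd[where J = I]) (use x in \<open>auto simp: space_PiM\<close>)
      show "(\<integral>y. (sg y - a) * T (x(i := y)) i \<partial>gauss \<mu>) \<le> J"
        unfolding J_def a_def
      proof (rule gauss_threshold_optimal)
        show "(\<lambda>y. T (x(i := y)) i) \<in> borel_measurable borel"
          using measurable_compose[OF upd T_meas[OF i]] .
        show "T (x(i := - y)) i = T (x(i := y)) i" for y
        proof -
          have "absrank N (x(i := - y)) i = absrank N (x(i := y)) i"
            unfolding absrank_def by (intro arg_cong[where f = card] Collect_cong) auto
          then show ?thesis by (simp add: T_def)
        qed
      qed (use T01 assms in auto)
    next
      \<comment> \<open>\<open>integral_mono'\<close> asks for a nonnegative majorant in place of
        integrability of the inner integral; the weight \<open>0\<close> gives it.\<close>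
      show "0 \<le> J"
        using gauss_threshold_optimal[of "\<lambda>_. 0" \<mu> r0] assms by (simp add: J_def)
    qed simp
    also have "\<dots> = J" by (simp add: Q.prob_space)
    finally show ?thesis .
  qed
  have "(\<Sum>s=1..j. 2 * measure (iid_gauss N \<mu>) {x \<in> space (iid_gauss N \<mu>). ord_stat N x s > 0} - 1)
      = (\<Sum>s=1..j. (\<integral>x. sg (ord_stat N x s) \<partial>iid_gauss N \<mu>))"
  proof (intro sum.cong refl)
    fix s
    define A where "A = {x \<in> space (iid_gauss N \<mu>). ord_stat N x s > 0}"
    have [measurable]: "A \<in> sets (iid_gauss N \<mu>)" unfolding A_def by measurable
    have "(\<integral>x. sg (ord_stat N x s) \<partial>iid_gauss N \<mu>) = (\<integral>x. 2 * indicator A x - 1 \<partial>iid_gauss N \<mu>)"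
      by (intro Bochner_Integration.integral_cong) (auto simp: sg_def A_def)
    also have "\<dots> = 2 * measure (iid_gauss N \<mu>) A - 1"
    proof -
      have "integrable (iid_gauss N \<mu>) (indicator A :: _ \<Rightarrow> real)"
        by (intro P.integrable_const_bound[where B = 1]) auto
      then show ?thesis by (simp add: P.prob_space)
    qed
    finally show "2 * measure (iid_gauss N \<mu>) A - 1 = (\<integral>x. sg (ord_stat N x s) \<partial>iid_gauss N \<mu>)" ..
  qed
  also have "\<dots> = (\<integral>x. (\<Sum>s=1..j. sg (ord_stat N x s)) \<partial>iid_gauss N \<mu>)"
    by (intro Bochner_Integration.integral_sum[symmetric] P.integrable_const_bound[where B = 1]) auto
  also have "\<dots> = (\<integral>x. (\<Sum>i<N. (sg (x i) - a) * T x i) + real j * a \<partial>iid_gauss N \<mu>)"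
  proof (intro Bochner_Integration.integral_cong refl)
    fix x
    have "(\<Sum>s=1..j. sg (ord_stat N x s)) = (\<Sum>i<N. sg (x i) * T x i)"
      unfolding T_def by (rule sum_ord_stat[OF assms(1)])
    moreover have "(\<Sum>i<N. T x i) = real j"
      unfolding T_def absrank_eq_lexrank by (rule sum_lexrank[OF assms(1)])
    ultimately show "(\<Sum>s=1..j. sg (ord_stat N x s)) = (\<Sum>i<N. (sg (x i) - a) * T x i) + real j * a"
      by (simp add: left_diff_distrib sum_subtractf sum_distrib_left[symmetric])
  qed
  also have "\<dots> = (\<Sum>i<N. (\<integral>x. (sg (x i) - a) * T x i \<partial>iid_gauss N \<mu>)) + real j * a"
  proof -
    have "integrable (iid_gauss N \<mu>) (\<lambda>x. \<Sum>i<N. (sg (x i) - a) * T x i)"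
      using int by (intro Bochner_Integration.integrable_sum) auto
    moreover have "(\<integral>x. (\<Sum>i<N. (sg (x i) - a) * T x i) \<partial>iid_gauss N \<mu>)
        = (\<Sum>i<N. (\<integral>x. (sg (x i) - a) * T x i \<partial>iid_gauss N \<mu>))"
      using int by (intro Bochner_Integration.integral_sum) auto
    ultimately show ?thesis by (simp add: P.prob_space)
  qed
  also have "\<dots> \<le> (\<Sum>i<N. J) + real j * a"
    using each by (intro add_right_mono sum_mono) auto
  finally show ?thesis by (simp add: J_def)
qed

text \<open>By exchangeability of the \<open>N + 1\<close> coordinates; counting strict inequalities only, at least \<open>j\<close>
  coordinates have fewer than \<open>j\<close> larger ones whether or not there are ties.\<close>
lemma prob_few_larger:
  fixes \<mu> :: real
  assumes "j \<le> N"
  defines "B \<equiv> {x \<in> space (iid_gauss (Suc N) \<mu>). card {l. l < N \<and> \<bar>x l\<bar> > \<bar>x N\<bar>} < j}"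
  shows "B \<in> sets (iid_gauss (Suc N) \<mu>)" "real j / (real N + 1) \<le> measure (iid_gauss (Suc N) \<mu>) B"
proof -
  define M where "M = iid_gauss (Suc N) \<mu>"
  interpret P: prob_space M unfolding M_def by (rule iid_gauss_prob_space)
  define A where "A i = {x \<in> space M. card {l. l < Suc N \<and> \<bar>x l\<bar> > \<bar>x i\<bar>} < j}" for i
  have comp: "(\<lambda>x. x i) \<in> borel_measurable M" if "i < Suc N" for i
    using that unfolding M_def by measurable
  have A_meas [measurable]: "A i \<in> sets M" if "i < Suc N" for i
  proof -
    have "(\<lambda>x. card {l. l < Suc N \<and> \<bar>x l\<bar> > \<bar>x i\<bar>}) \<in> measurable M (count_space UNIV)"
    proof (rule measurable_card)
      fix l
      show "{x \<in> space M. l \<in> {l. l < Suc N \<and> \<bar>x i\<bar> < \<bar>x l\<bar>}} \<in> sets M"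
      proof (cases "l < Suc N")
        case True
        have "{x \<in> space M. \<bar>x i\<bar> < \<bar>x l\<bar>} \<in> sets M"
          by (intro borel_measurable_less borel_measurable_abs comp that True)
        with True show ?thesis by simp
      qed simp
    qed
    then have "(\<lambda>x. card {l. l < Suc N \<and> \<bar>x l\<bar> > \<bar>x i\<bar>}) -` {..<j} \<inter> space M \<in> sets M"
      by (rule measurable_sets) simp
    also have "(\<lambda>x. card {l. l < Suc N \<and> \<bar>x l\<bar> > \<bar>x i\<bar>}) -` {..<j} \<inter> space M = A i"
      unfolding A_def by blast
    finally show ?thesis .
  qed
  have exch: "measure M (A i) = measure M (A N)" if i: "i < Suc N" for i
  proof -
    \<comment> \<open>Swapping coordinate \<open>i\<close> with the last one preserves the product
      law and pulls \<open>A N\<close> back to \<open>A i\<close>.\<close>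
    define p where "p = Transposition.transpose i N"
    have p: "p permutes {..<Suc N}" "p N = i"
      unfolding p_def using i by (intro permutes_swap_id; simp) simp
    define \<phi> where "\<phi> = (\<lambda>x :: nat \<Rightarrow> real. \<lambda>l\<in>{..<Suc N}. x (p l))"
    have D: "distr M M \<phi> = M"
      using distr_PiM_reindex[of "{..<Suc N}" "\<lambda>_. gauss \<mu>" p "{..<Suc N}"]
        permutes_inj_on[OF p(1)] permutes_in_image[OF p(1)] prob_space_gauss
      by (auto simp: M_def iid_gauss_def \<phi>_def)
    have \<phi>_meas: "\<phi> \<in> measurable M M"
      unfolding \<phi>_def M_def iid_gauss_def
      by (rule measurable_restrict) (use permutes_in_image[OF p(1)] in auto)
    have "\<phi> -` A N \<inter> space M = A i"
    proof -
      have "card {l. l < Suc N \<and> \<bar>\<phi> x l\<bar> > \<bar>\<phi> x N\<bar>} = card {l. l < Suc N \<and> \<bar>x l\<bar> > \<bar>x i\<bar>}" for x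
      proof -
        have pl: "p l < Suc N \<longleftrightarrow> l < Suc N" for l
          using permutes_in_image[OF p(1), of l] by simp
        have "bij_betw p {l. l < Suc N \<and> \<bar>\<phi> x l\<bar> > \<bar>\<phi> x N\<bar>} {l. l < Suc N \<and> \<bar>x l\<bar> > \<bar>x i\<bar>}"
        proof (rule bij_betwI')
          fix m assume m: "m \<in> {l. l < Suc N \<and> \<bar>x l\<bar> > \<bar>x i\<bar>}"
          obtain l where l: "m = p l" using permutes_surj[OF p(1)] by (metis surjD)
          show "\<exists>l\<in>{l. l < Suc N \<and> \<bar>\<phi> x l\<bar> > \<bar>\<phi> x N\<bar>}. m = p l"
            using m pl[of l] p(2) by (intro bexI[where x = l]) (simp_all add: \<phi>_def l)
        qed (use pl p(2) permutes_inj[OF p(1)] in \<open>auto simp: \<phi>_def inj_eq split: if_splits\<close>)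
        then show ?thesis by (rule bij_betw_same_card)
      qed
      then show ?thesis
        using measurable_space[OF \<phi>_meas] by (auto simp: A_def)
    qed
    then show ?thesis
      using measure_distr[OF \<phi>_meas, of "A N"] A_meas[of N] D by simp
  qed
  have "real j \<le> (\<Sum>i<Suc N. indicator (A i) x)" if x: "x \<in> space M" for x
  proof -
    have "real j = (\<Sum>i<Suc N. if absrank (Suc N) x i < j then 1 else 0)"
      using assms unfolding absrank_eq_lexrank by (subst sum_lexrank) auto
    also have "\<dots> \<le> (\<Sum>i<Suc N. indicator (A i) x)"
    proof (intro sum_mono)
      fix i
      have "card {l. l < Suc N \<and> \<bar>x l\<bar> > \<bar>x i\<bar>} \<le> absrank (Suc N) x i"
        unfolding absrank_def by (intro card_mono) auto
      then show "(if absrank (Suc N) x i < j then 1 else 0) \<le> (indicator (A i) x :: real)"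
        using x by (auto simp: A_def)
    qed
    finally show ?thesis .
  qed
  moreover have intA: "integrable M (indicator (A i) :: _ \<Rightarrow> real)" if "i < Suc N" for i
    using A_meas[OF that] by (intro P.integrable_const_bound[where B = 1]) auto
  ultimately have "(\<integral>x. real j \<partial>M) \<le> (\<integral>x. (\<Sum>i<Suc N. indicator (A i) x) \<partial>M)"
    using intA by (intro integral_mono P.integrable_const Bochner_Integration.integrable_sum)
      (auto simp del: sum.lessThan_Suc)
  also have "\<dots> = (\<Sum>i<Suc N. measure M (A i))"
    using intA A_meas by (subst Bochner_Integration.integral_sum) (auto simp del: sum.lessThan_Suc intro!: sum.cong)
  also have "\<dots> = (\<Sum>i<Suc N. measure M (A N))"
    by (intro sum.cong refl exch) simp
  finally have "real j \<le> (real N + 1) * measure M (A N)"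
    by (simp add: P.prob_space algebra_simps)
  moreover have AB: "A N = B"
  proof -
    have "{l. l < Suc N \<and> \<bar>x l\<bar> > \<bar>x N\<bar>} = {l. l < N \<and> \<bar>x l\<bar> > \<bar>x N\<bar>}" for x :: "nat \<Rightarrow> real"
      by (auto simp: less_Suc_eq)
    then show ?thesis by (simp add: A_def B_def M_def)
  qed
  ultimately show "real j / (real N + 1) \<le> measure (iid_gauss (Suc N) \<mu>) B" by (simp add: M_def pos_divide_le_eq mult.commute)
  show "B \<in> sets (iid_gauss (Suc N) \<mu>)"
    using A_meas[of N] AB by (simp add: M_def)
qed

text \<open>Conditioning on the absolute value \<open>R\<close> of the \<open>j\<close>-th order
  statistic turns \<open>qprob\<close> into the mean of \<open>gtail 0\<close> at \<open>R\<close>.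
  One more exchangeable non-null shows that the mean of \<open>gtail \<mu>\<close> at
  \<open>R\<close> is at least its value at \<open>r0\<close>; the tangent line at
  \<open>r0\<close>, of nonnegative slope, carries this over to the null tail.\<close>

lemma qprob_ge:
  assumes "1 \<le> j" "j \<le> N" "0 \<le> r0" "gtail \<mu> r0 = real j / (real N + 1)"
  shows "gtail 0 r0 \<le> qprob N \<mu> j"
proof -
  interpret P: prob_space "iid_gauss N \<mu>" by (rule iid_gauss_prob_space)
  interpret S: prob_space "iid_gauss (Suc N) \<mu>" by (rule iid_gauss_prob_space)
  interpret PS: product_sigma_finite "\<lambda>_::nat. gauss \<mu>" ..
  interpret G: pair_prob_space "gauss 0" "iid_gauss N \<mu>" ..
  define R where "R x = \<bar>ord_stat N x j\<bar>" for x
  have R_meas [measurable]: "R \<in> borel_measurable (iid_gauss N \<mu>)"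
    unfolding R_def by measurable
  have gtail_int: "integrable (iid_gauss N \<mu>) (\<lambda>x. gtail \<nu> (R x))" for \<nu>
    by (rule P.integrable_const_bound[where B = 1]) (auto simp: gtail_def)
  have nn: "(\<integral>\<^sup>+x. ennreal (gtail \<nu> (R x)) \<partial>iid_gauss N \<mu>) = ennreal (\<integral>x. gtail \<nu> (R x) \<partial>iid_gauss N \<mu>)" for \<nu>
    by (rule nn_integral_eq_integral[OF gtail_int]) (simp add: gtail_def)
  have gn: "0 \<le> (\<integral>x. gtail \<nu> (R x) \<partial>iid_gauss N \<mu>)" for \<nu>
    by (simp add: gtail_def)
  have q: "qprob N \<mu> j = (\<integral>x. gtail 0 (R x) \<partial>iid_gauss N \<mu>)"
  proof -
    define X where "X = {(z, x). \<bar>z\<bar> > R x} \<inter> space (gauss 0 \<Otimes>\<^sub>M iid_gauss N \<mu>)"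
    have "X = {w \<in> space (gauss 0 \<Otimes>\<^sub>M iid_gauss N \<mu>). R (snd w) < \<bar>fst w\<bar>}"
      unfolding X_def by auto
    also have "\<dots> \<in> sets (gauss 0 \<Otimes>\<^sub>M iid_gauss N \<mu>)"
      by measurable
    finally have "emeasure (gauss 0 \<Otimes>\<^sub>M iid_gauss N \<mu>) X
        = (\<integral>\<^sup>+x. emeasure (gauss 0) ((\<lambda>z. (z, x)) -` X) \<partial>iid_gauss N \<mu>)"
      by (rule G.emeasure_pair_measure_alt2)
    also have "\<dots> = (\<integral>\<^sup>+x. ennreal (gtail 0 (R x)) \<partial>iid_gauss N \<mu>)"
    proof (intro nn_integral_cong)
      fix x assume "x \<in> space (iid_gauss N \<mu>)"
      then have "(\<lambda>z. (z, x)) -` X = {z. \<bar>z\<bar> > R x}"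
        by (auto simp: X_def space_pair_measure)
      then show "emeasure (gauss 0) ((\<lambda>z. (z, x)) -` X) = ennreal (gtail 0 (R x))"
        by (simp add: gtail_def gauss.emeasure_eq_measure)
    qed
    finally have "measure (gauss 0 \<Otimes>\<^sub>M iid_gauss N \<mu>) X = (\<integral>x. gtail 0 (R x) \<partial>iid_gauss N \<mu>)"
      unfolding nn using gn by (simp add: G.P.emeasure_eq_measure)
    then show ?thesis by (simp add: qprob_def X_def R_def)
  qed
  \<comment> \<open>Coordinate \<open>N\<close> is a fresh copy independent of the first
    \<open>N\<close>; if fewer than \<open>j\<close> of those exceed it in absolute value, its own
    absolute value is at least \<open>R\<close>.\<close>
  have u: "real j / (real N + 1) \<le> (\<integral>x. gtail \<mu> (R x) \<partial>iid_gauss N \<mu>)"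
  proof -
    define B where "B = {x \<in> space (iid_gauss (Suc N) \<mu>). card {l. l < N \<and> \<bar>x l\<bar> > \<bar>x N\<bar>} < j}"
    note few = prob_few_larger[OF assms(2), of \<mu>, folded B_def]
    have Suc: "insert N {..<N} = {..<Suc N}" by auto
    have "ennreal (real j / (real N + 1)) \<le> emeasure (iid_gauss (Suc N) \<mu>) B"
      using few(2) by (simp add: S.emeasure_eq_measure)
    also have "\<dots> = (\<integral>\<^sup>+x. indicator B x \<partial>iid_gauss (Suc N) \<mu>)"
      using few(1) by simp
    also have "\<dots> = (\<integral>\<^sup>+x. (\<integral>\<^sup>+y. indicator B (x(N := y)) \<partial>gauss \<mu>) \<partial>iid_gauss N \<mu>)"
      using PS.product_nn_integral_insert[of "{..<N}" N "indicator B"] few(1)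
      unfolding Suc by (simp add: iid_gauss_def)
    also have "\<dots> \<le> (\<integral>\<^sup>+x. ennreal (gtail \<mu> (R x)) \<partial>iid_gauss N \<mu>)"
    proof (intro nn_integral_mono)
      fix x
      have "y \<in> {y. \<bar>y\<bar> \<ge> R x}" if "x(N := y) \<in> B" for y
      proof -
        have "{l. l < N \<and> \<bar>(x(N := y)) l\<bar> > \<bar>(x(N := y)) N\<bar>} = {l. l < N \<and> \<bar>x l\<bar> > \<bar>y\<bar>}"
          by auto
        then have "card {l. l < N \<and> \<bar>x l\<bar> > \<bar>y\<bar>} < j" using that by (simp add: B_def)
        then show ?thesis using abs_ord_stat_le[OF assms(1,2)] by (simp add: R_def)
      qed
      then have "(\<integral>\<^sup>+y. indicator B (x(N := y)) \<partial>gauss \<mu>) \<le> (\<integral>\<^sup>+y. indicator {y. \<bar>y\<bar> \<ge> R x} y \<partial>gauss \<mu>)"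
        by (intro nn_integral_mono) (auto simp: indicator_def)
      also have "\<dots> = ennreal (measure (gauss \<mu>) {y. \<bar>y\<bar> \<ge> R x})"
        by (subst nn_integral_indicator) (auto simp: gauss.emeasure_eq_measure)
      also have "\<dots> = ennreal (gtail \<mu> (R x))"
        by (subst gtail_ge) (auto simp: R_def)
      finally show "(\<integral>\<^sup>+y. indicator B (x(N := y)) \<partial>gauss \<mu>) \<le> ennreal (gtail \<mu> (R x))" .
    qed
    finally show ?thesis unfolding nn using gn by simp
  qed
  define \<kappa> where "\<kappa> = exp (\<mu>\<^sup>2 / 2) / cosh (\<mu> * r0)"
  have "\<kappa> \<ge> 0" by (simp add: \<kappa>_def)
  have "gtail 0 r0 \<le> gtail 0 r0 + \<kappa> * ((\<integral>x. gtail \<mu> (R x) \<partial>iid_gauss N \<mu>) - gtail \<mu> r0)"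
    using u \<open>\<kappa> \<ge> 0\<close> assms(4) by simp
  also have "\<dots> = (\<integral>x. gtail 0 r0 + \<kappa> * (gtail \<mu> (R x) - gtail \<mu> r0) \<partial>iid_gauss N \<mu>)"
    using gtail_int by (simp add: P.prob_space)
  also have "\<dots> \<le> (\<integral>x. gtail 0 (R x) \<partial>iid_gauss N \<mu>)"
  proof (rule integral_mono)
    fix x
    show "gtail 0 r0 + \<kappa> * (gtail \<mu> (R x) - gtail \<mu> r0) \<le> gtail 0 (R x)"
      using gtail_tangent[of "R x" r0 \<mu>] assms(3) by (simp add: R_def \<kappa>_def)
  qed (use gtail_int in auto)
  finally show ?thesis using q by simp
qed

subsection \<open>The test at a fixed threshold\<close>

lemma prob_space_data_law: "prob_space (data_law n S \<mu>)"
  unfolding data_law_def by (intro prob_space_PiM) (simp add: prob_space_gauss)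

lemma data_law_component [measurable]:
  assumes "i < n" shows "(\<lambda>Z. Z i) \<in> borel_measurable (data_law n S \<mu>)"
proof -
  let ?G = "if i \<in> S then gauss \<mu> else gauss 0"
  have "(\<lambda>Z. Z i) \<in> measurable (data_law n S \<mu>) ?G"
    unfolding data_law_def using assms by (intro measurable_component_singleton) simp
  moreover have "measurable (data_law n S \<mu>) ?G = borel_measurable (data_law n S \<mu>)"
    by (rule measurable_cong_sets) simp_all
  ultimately show ?thesis by simp
qed

lemma Phi_measurable [measurable]: "Phi \<in> borel_measurable borel"
  by (intro borel_measurable_mono strict_mono_mono Phi_strict_mono)

lemma rejects_measurable: "{Z \<in> space (data_law n S \<mu>). rejects n \<alpha> Z} \<in> sets (data_law n S \<mu>)"
proof -
  let ?M = "data_law n S \<mu>"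
  have gr: "(\<lambda>Z. grank n Z i) \<in> measurable ?M (count_space UNIV)" if "i < n" for i
    unfolding grank_eq_lexrank gfun_pval using that by (intro lexrank_measurable) measurable
  have term_meas: "(\<lambda>Z. if grank n Z i < k then sg (Z i) else 0) \<in> borel_measurable ?M" if "i < n" for i k
  proof -
    note [measurable] = gr[OF that] data_law_component[OF that]
    show ?thesis by measurable
  qed
  have "(\<Sum>i\<in>Mset n Z k. hfun (pval Z i)) = (\<Sum>i<n. if grank n Z i < k then sg (Z i) else 0)" for Z k
  proof -
    have "Mset n Z k = {i \<in> {..<n}. grank n Z i < k}" by (auto simp: Mset_def)
    then have "(\<Sum>i\<in>Mset n Z k. hfun (pval Z i)) = (\<Sum>i\<in>{i \<in> {..<n}. grank n Z i < k}. sg (Z i))"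
      by (auto simp: hfun_pval sg_def intro!: sum.cong)
    then show ?thesis by (subst (asm) sum.inter_filter) auto
  qed
  then have "{Z \<in> space ?M. rejects n \<alpha> Z} = (\<Union>k\<in>{1..n}. {Z \<in> space ?M.
      (\<Sum>i<n. if grank n Z i < k then sg (Z i) else 0) > Cconst k \<alpha> * sqrt (real k)})"
    by (auto simp: rejects_def)
  also have "\<dots> \<in> sets ?M"
    by (intro sets.finite_UN borel_measurable_less borel_measurable_sum term_meas) auto
  finally show ?thesis .
qed

text \<open>The hypotheses above \<open>r\<close> form \<open>Mset\<close> at their own random
  number \<open>k\<close>, and monotonicity of \<open>Cconst\<close> lets the constant at
  \<open>n\<close> serve for every such \<open>k\<close>.\<close>

lemma rejects_if_threshold_sum:
  fixes r :: real and Z :: "nat \<Rightarrow> real"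
  assumes "1 \<le> n" "0 < \<alpha>" "\<alpha> \<le> 1"
  defines "k \<equiv> card {i. i < n \<and> \<bar>Z i\<bar> > r}"
  assumes "(\<Sum>i<n. if \<bar>Z i\<bar> > r then sg (Z i) else 0) > Cconst n \<alpha> * sqrt (real k)"
  shows "rejects n \<alpha> Z"
proof -
  have B: "{i. i < n \<and> \<bar>Z i\<bar> > r} = {l. l < n \<and> gfun (pval Z l) < Phi (- r)}"
    using strict_mono_less[OF Phi_strict_mono] by (auto simp: gfun_pval)
  have "Mset n Z k = {i. i < n \<and> \<bar>Z i\<bar> > r}"
    unfolding Mset_def grank_eq_lexrank k_def B
    using lexrank_less_card_iff[of _ n "\<lambda>l. gfun (pval Z l)" "Phi (- r)"] by auto
  then have "(\<Sum>i\<in>Mset n Z k. hfun (pval Z i)) = (\<Sum>i\<in>{i \<in> {..<n}. \<bar>Z i\<bar> > r}. sg (Z i))"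
    by (auto simp: hfun_pval sg_def intro!: sum.cong)
  then have sum: "(\<Sum>i\<in>Mset n Z k. hfun (pval Z i)) = (\<Sum>i<n. if \<bar>Z i\<bar> > r then sg (Z i) else 0)"
    by (subst (asm) sum.inter_filter) auto
  \<comment> \<open>An empty set would make both sides of the assumed strict inequality
    \<open>0\<close>.\<close>
  have k1: "1 \<le> k"
  proof (rule ccontr)
    assume "\<not> 1 \<le> k"
    then have "card {i. i < n \<and> \<bar>Z i\<bar> > r} = 0" unfolding k_def by linarith
    then have "{i. i < n \<and> \<bar>Z i\<bar> > r} = {}" by (subst (asm) card_0_eq) auto
    then have "(\<Sum>i<n. if \<bar>Z i\<bar> > r then sg (Z i) else 0) = 0" by (intro sum.neutral) auto
    moreover have "k = 0" using \<open>\<not> 1 \<le> k\<close> by linarith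
    ultimately show False using assms(5) by simp
  qed
  have kn: "k \<le> n"
    using card_mono[of "{..<n}" "{i. i < n \<and> \<bar>Z i\<bar> > r}"] by (auto simp: k_def)
  have "Cconst k \<alpha> * sqrt (real k) \<le> Cconst n \<alpha> * sqrt (real k)"
    using Cconst_bounds(3)[OF assms(1-3) k1 kn] by (intro mult_right_mono) auto
  then have "Cconst k \<alpha> * sqrt (real k) < (\<Sum>i\<in>Mset n Z k. hfun (pval Z i))"
    using assms(5) unfolding sum by (rule le_less_trans)
  then show ?thesis
    unfolding rejects_def using k1 kn by (intro bexI[of _ "k"]) auto
qed

section \<open>The Chernoff bound for the thresholded sum of signs\<close>

lemma gauss_exp_threshold:
  fixes c \<theta> r \<nu> :: real
  assumes "0 \<le> r"
  defines "F \<equiv> (\<integral>y. sg y * indicator {y. \<bar>y\<bar> > r} y \<partial>gauss \<nu>)"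
  shows "(\<integral>y. exp (- \<theta> * (if \<bar>y\<bar> > r then sg y - c else 0)) \<partial>gauss \<nu>)
    \<le> exp (gtail \<nu> r * (exp (\<theta> * c) * cosh \<theta> - 1) - exp (\<theta> * c) * sinh \<theta> * F)"
proof -
  let ?I = "indicator {y. \<bar>y\<bar> > r} :: real \<Rightarrow> real"
  have I [measurable]: "integrable (gauss \<nu>) ?I"
    by (intro gauss.integrable_const_bound[where B = 1]) auto
  have sI: "integrable (gauss \<nu>) (\<lambda>y. sg y * ?I y)"
    by (intro gauss.integrable_const_bound[where B = 1]) (auto simp: abs_mult)
  have "(\<integral>y. exp (- \<theta> * (if \<bar>y\<bar> > r then sg y - c else 0)) \<partial>gauss \<nu>)
      = (\<integral>y. 1 + ((exp (\<theta> * c) * cosh \<theta> - 1) * ?I y - exp (\<theta> * c) * sinh \<theta> * (sg y * ?I y)) \<partial>gauss \<nu>)"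
  proof (intro Bochner_Integration.integral_cong refl)
    fix y :: real
    \<comment> \<open>A sign takes only two values, so the exponential is affine in it: above the
      threshold it is
      \<open>exp (\<theta> * c) * (cosh \<theta> - sg y * sinh \<theta>)\<close>.\<close>
    have "exp (\<theta> * c - \<theta>) = exp (\<theta> * c) * (cosh \<theta> - sinh \<theta>)"
      by (simp add: cosh_minus_sinh exp_diff exp_minus divide_inverse)
    moreover have "exp (\<theta> * c + \<theta>) = exp (\<theta> * c) * (cosh \<theta> + sinh \<theta>)"
      by (simp add: cosh_plus_sinh exp_add)
    ultimately show "exp (- \<theta> * (if \<bar>y\<bar> > r then sg y - c else 0))
        = 1 + ((exp (\<theta> * c) * cosh \<theta> - 1) * ?I y - exp (\<theta> * c) * sinh \<theta> * (sg y * ?I y))"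
      by (auto simp: sg_def algebra_simps)
  qed
  also have "\<dots> = 1 + (gtail \<nu> r * (exp (\<theta> * c) * cosh \<theta> - 1) - exp (\<theta> * c) * sinh \<theta> * F)"
    using I sI gauss.prob_space[of \<nu>] by (simp add: F_def gtail_def)
  also have "\<dots> \<le> exp (gtail \<nu> r * (exp (\<theta> * c) * cosh \<theta> - 1) - exp (\<theta> * c) * sinh \<theta> * F)"
    by (rule exp_ge_add_one_self)
  finally show ?thesis .
qed

text \<open>The integrand is odd; \<open>0 \<le> r\<close> keeps the origin, where \<open>sg\<close>
  fails to be odd, outside the indicator.\<close>

lemma gauss_0_sign_mean: "(\<integral>y. sg y * indicator {y. \<bar>y\<bar> > r} y \<partial>gauss 0) = 0" if "0 \<le> r"
proof -
  let ?h = "\<lambda>y. normal_density 0 1 y * (sg y * indicator {y. \<bar>y\<bar> > r} y)"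
  have int: "integrable lborel ?h"
    by (rule integrable_normal_density_mult[where B = 1]) (auto simp: indicator_def abs_mult)
  have odd: "?h (- y) = - ?h y" for y
    using that by (auto simp: normal_density_uminus sg_def indicator_def)
  have "0 \<le> integral\<^sup>L lborel ?h"
    using odd by (intro integral_lborel_nonneg_symmetrized int) simp
  moreover have "0 \<le> integral\<^sup>L lborel (\<lambda>y. - ?h y)"
    using odd int by (intro integral_lborel_nonneg_symmetrized) auto
  ultimately show ?thesis by (subst integral_gauss) auto
qed

text \<open>Exponential Markov inequality with parameter \<open>\<theta>\<close>; independence
  factorizes the moment generating function, and the nulls contribute no sign term by
  \<open>gauss_0_sign_mean\<close>.\<close>

lemma threshold_sum_tail:
  fixes \<mu> r \<theta> c b :: real
  assumes S: "S \<subseteq> {..<N0 + N1}" "card S = N1" and "0 \<le> r" "0 \<le> \<theta>"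
  defines "F \<equiv> (\<integral>y. sg y * indicator {y. \<bar>y\<bar> > r} y \<partial>gauss \<mu>)"
  defines "M \<equiv> data_law (N0 + N1) S \<mu>"
  shows "measure M {Z \<in> space M. (\<Sum>i<N0 + N1. if \<bar>Z i\<bar> > r then sg (Z i) - c else 0) \<le> b}
    \<le> exp (\<theta> * b + (real N0 * gtail 0 r + real N1 * gtail \<mu> r) * (exp (\<theta> * c) * cosh \<theta> - 1)
           - exp (\<theta> * c) * sinh \<theta> * (real N1 * F))"
proof -
  let ?n = "N0 + N1"
  interpret P: prob_space M unfolding M_def by (rule prob_space_data_law)
  define G where "G = (\<lambda>i. if i \<in> S then gauss \<mu> else gauss 0)"
  interpret G: prob_space "G i" for i by (simp add: G_def prob_space_gauss)
  interpret PS: product_sigma_finite G ..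
  have M: "M = PiM {..<?n} G" by (simp add: M_def data_law_def G_def)
  have setsG [simp]: "sets (G i) = sets borel" for i by (simp add: G_def)
  have measG: "borel_measurable (G i) = borel_measurable borel" for i
    by (intro measurable_cong_sets) auto
  define X where "X y = (if \<bar>y\<bar> > r then sg y - c else 0)" for y
  have X_meas [measurable]: "X \<in> borel_measurable borel" unfolding X_def by measurable
  have X_bd: "\<bar>X y\<bar> \<le> 1 + \<bar>c\<bar>" for y by (auto simp: X_def sg_def)
  define f where "f y = exp (- \<theta> * X y)" for y
  have f_bd: "\<bar>f y\<bar> \<le> exp (\<theta> * (1 + \<bar>c\<bar>))" for y
  proof -
    have "\<theta> * (- X y) \<le> \<theta> * (1 + \<bar>c\<bar>)"
      using X_bd[of y] assms by (intro mult_left_mono) auto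
    then show ?thesis by (simp add: f_def)
  qed
  have f_meas [measurable]: "f \<in> borel_measurable borel" unfolding f_def by measurable
  have f_measG: "f \<in> borel_measurable (G i)" for i
    unfolding measG by (rule f_meas)
  have f_int: "integrable (G i) f" for i
    by (rule G.integrable_const_bound[of _ "exp (\<theta> * (1 + \<bar>c\<bar>))"]) (simp_all add: f_bd f_measG)
  define W where "W Z = (\<Sum>i<?n. X (Z i))" for Z
  have W_meas: "W \<in> borel_measurable M"
    unfolding W_def M_def
    by (intro borel_measurable_sum measurable_compose[OF data_law_component X_meas]) auto
  have prod: "exp (- \<theta> * W Z) = (\<Prod>i<?n. f (Z i))" for Z
    by (simp add: W_def f_def sum_distrib_left exp_sum)
  have int: "integrable M (\<lambda>Z. \<Prod>i<?n. f (Z i))"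
    unfolding M by (intro PS.product_integrable_prod f_int) auto
  have "{Z \<in> space M. W Z \<le> b} \<in> sets M" using W_meas by measurable
  then have "measure M {Z \<in> space M. W Z \<le> b} = (\<integral>Z. indicator {Z \<in> space M. W Z \<le> b} Z \<partial>M)"
    by simp
  also have "\<dots> \<le> (\<integral>Z. exp (\<theta> * b) * (\<Prod>i<?n. f (Z i)) \<partial>M)"
  proof (rule integral_mono)
    show "integrable M (indicator {Z \<in> space M. W Z \<le> b} :: _ \<Rightarrow> real)"
      using \<open>_ \<in> sets M\<close> by (intro P.integrable_const_bound[where B = 1]) auto
    show "integrable M (\<lambda>Z. exp (\<theta> * b) * (\<Prod>i<?n. f (Z i)))" using int by simp
    fix Z
    have "1 \<le> exp (\<theta> * (b - W Z))" if "W Z \<le> b"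
      using that assms by simp
    then show "indicator {Z \<in> space M. W Z \<le> b} Z \<le> exp (\<theta> * b) * (\<Prod>i<?n. f (Z i))"
      unfolding prod[symmetric] by (auto simp: indicator_def exp_add[symmetric] algebra_simps)
  qed
  also have "\<dots> = exp (\<theta> * b) * (\<Prod>i<?n. \<integral>y. f y \<partial>G i)"
    using PS.product_integral_prod[of "{..<?n}" "\<lambda>_. f"] f_int by (simp add: M)
  also have "\<dots> \<le> exp (\<theta> * b) * (\<Prod>i<?n. exp (if i \<in> S then gtail \<mu> r * (exp (\<theta> * c) * cosh \<theta> - 1) - exp (\<theta> * c) * sinh \<theta> * F
      else gtail 0 r * (exp (\<theta> * c) * cosh \<theta> - 1)))"
  proof (intro mult_left_mono prod_mono conjI)
    fix i
    show "0 \<le> (\<integral>y. f y \<partial>G i)" by (simp add: f_def)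
    show "(\<integral>y. f y \<partial>G i) \<le> exp (if i \<in> S then gtail \<mu> r * (exp (\<theta> * c) * cosh \<theta> - 1) - exp (\<theta> * c) * sinh \<theta> * F
      else gtail 0 r * (exp (\<theta> * c) * cosh \<theta> - 1))"
      using gauss_exp_threshold[OF assms(3), where \<theta> = \<theta> and c = c and \<nu> = \<mu>]
        gauss_exp_threshold[OF assms(3), where \<theta> = \<theta> and c = c and \<nu> = 0]
        gauss_0_sign_mean[OF assms(3)]
      by (auto simp: G_def f_def X_def F_def)
  qed simp
  also have "\<dots> = exp (\<theta> * b + (\<Sum>i<?n. if i \<in> S then gtail \<mu> r * (exp (\<theta> * c) * cosh \<theta> - 1) - exp (\<theta> * c) * sinh \<theta> * F
      else gtail 0 r * (exp (\<theta> * c) * cosh \<theta> - 1)))"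
    by (simp add: exp_add exp_sum)
  also have "(\<Sum>i<?n. if i \<in> S then u else v) = real N1 * u + real N0 * v" for u v :: real
  proof -
    have S_eq: "{..<?n} \<inter> S = S" "{..<?n} \<inter> - S = {..<?n} - S"
      using S(1) by auto
    have "card ({..<?n} - S) = N0"
      using S by (subst card_Diff_subset) (auto intro: finite_subset)
    then show ?thesis using S(2) by (simp add: sum.If_cases S_eq)
  qed
  finally show ?thesis by (simp add: W_def X_def algebra_simps)
qed

text \<open>Here \<open>\<tau>\<close> and \<open>j - u\<close> stand for the expected numbers of
  nulls and non-nulls above the threshold, and \<open>f\<close> for the expected sum of signs. With
  \<open>\<tau> = t\<close> and \<open>u = 0\<close> the exponent would be at most
  \<open>- (j + t) * \<theta>\<^sup>2 / 2\<close>; the excess \<open>t / j\<close> costs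
  \<open>1 / 4\<close> and \<open>u\<close> costs \<open>1\<close>.\<close>

lemma exponent_bound:
  fixes \<theta> c j t \<tau> u m f :: real
  assumes "0 \<le> \<theta>" "0 \<le> c" "1 \<le> j" "0 \<le> t" "0 \<le> u" "u \<le> 1"
    and m: "(2 * c + \<theta>) * (j + t) \<le> m" "m \<le> j"
    and \<tau>: "\<tau> \<le> t + t / j" and f: "m - u \<le> f"
  shows "\<theta> * (c * (j + t)) + (\<tau> + (j - u)) * (exp (\<theta> * c) * cosh \<theta> - 1) - exp (\<theta> * c) * sinh \<theta> * f
    \<le> 5 / 4 - (j + t) * \<theta>\<^sup>2 / 2"
proof -
  define K where "K = j + t"
  define y where "y = 2 * c + \<theta>"
  define E where "E = exp (\<theta> * c)"
  define Y where "Y = E * cosh \<theta> - 1"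
  define S where "S = E * sinh \<theta>"
  have K: "0 < K" "j \<le> K" using assms by (auto simp: K_def)
  have y0: "0 \<le> y" "\<theta> \<le> y" using assms by (auto simp: y_def)
  have yK: "y \<le> j / K" using m K by (simp add: y_def K_def pos_le_divide_eq)
  also have "j / K \<le> 1" using K by simp
  finally have y1: "2 * c + \<theta> \<le> 1" by (simp add: y_def)
  have E1: "1 \<le> E" using assms by (simp add: E_def)
  have "1 * 1 \<le> E * cosh \<theta>" using E1 cosh_real_ge_1 by (intro mult_mono) auto
  then have Y0: "0 \<le> Y" by (simp add: Y_def)
  have S0: "0 \<le> S" using assms E1 by (simp add: S_def)
  \<comment> \<open>Both \<open>\<theta>\<close> and \<open>y\<close> are at most
    \<open>j / K\<close>, so the excess costs at most \<open>t * j / (j + t)\<^sup>2\<close>, hence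
    \<open>1 / 4\<close> by the arithmetic-geometric mean inequality.\<close>
  have "t / j * Y \<le> t / j * (j / K * (j / K))"
  proof (intro mult_left_mono)
    have "Y \<le> \<theta> * y"
      using chernoff_exponent_le(2)[OF assms(1,2) y1] by (simp add: Y_def E_def y_def)
    also have "\<dots> \<le> j / K * (j / K)" using y0 yK assms by (intro mult_mono) auto
    finally show "Y \<le> j / K * (j / K)" .
  qed (use assms in auto)
  also have "\<dots> = t * j / (K * K)" using assms by simp
  also have "\<dots> \<le> 1 / 4"
  proof -
    have "t * j \<le> 1 / 4 * (K * K)"
      using zero_le_square[of "t - j"] by (simp add: K_def algebra_simps)
    then show ?thesis using K by (subst pos_divide_le_eq) auto
  qed
  finally have 1: "t / j * Y \<le> 1 / 4" .
  \<comment> \<open>The shortfall \<open>u\<close> enters the count and the signs with net effect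
    \<open>u * (S - Y)\<close>; \<open>cosh\<close> and \<open>sinh\<close> combine to an
    exponential, which keeps \<open>S - Y\<close> below \<open>1\<close>.\<close>
  have "S - Y = 1 - E * exp (- \<theta>)"
    by (simp add: S_def Y_def cosh_minus_sinh[symmetric] algebra_simps)
  also have "\<dots> \<le> 1" using E1 by simp
  finally have "u * (S - Y) \<le> u * 1" using assms by (intro mult_left_mono) auto
  then have 2: "u * (S - Y) \<le> 1" using assms by simp
  have 3: "\<theta> * (c * K) + K * Y - S * m \<le> - K * \<theta>\<^sup>2 / 2"
  proof -
    have "S * (y * K) \<le> S * m" using m S0 by (intro mult_left_mono) (auto simp: y_def K_def)
    moreover have "K * (E * (cosh \<theta> - sinh \<theta> * y)) \<le> K * (1 - \<theta> * c - \<theta>\<^sup>2 / 2)"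
      using chernoff_exponent_le(1)[OF assms(1,2) y1] K
      by (intro mult_left_mono) (auto simp: E_def y_def)
    ultimately show ?thesis by (simp add: S_def Y_def algebra_simps)
  qed
  have 4: "\<tau> * Y \<le> (t + t / j) * Y" using \<tau> Y0 by (rule mult_right_mono)
  have 5: "S * (m - u) \<le> S * f" using f S0 by (rule mult_left_mono)
  have "\<theta> * (c * K) + (\<tau> + (j - u)) * Y - S * f \<le> 5 / 4 - K * \<theta>\<^sup>2 / 2"
  proof -
    have "(\<tau> + (j - u)) * Y = \<tau> * Y + j * Y - u * Y" "S * (m - u) = S * m - u * S"
      "(t + t / j) * Y = t * Y + t / j * Y" "u * (S - Y) = u * S - u * Y" "K * Y = j * Y + t * Y"
      by (simp_all add: K_def algebra_simps)
    moreover have "- K * \<theta>\<^sup>2 / 2 = - (K * \<theta>\<^sup>2 / 2)" by simp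
    ultimately show ?thesis using 1 2 3 4 5 by linarith
  qed
  then show ?thesis by (simp add: K_def Y_def S_def E_def)
qed

lemma qprob_bounds: "0 \<le> qprob N \<mu> j" "qprob N \<mu> j \<le> 1"
proof -
  interpret Q: prob_space "iid_gauss N \<mu>" by (rule iid_gauss_prob_space)
  interpret pair_prob_space "gauss 0" "iid_gauss N \<mu>" ..
  show "0 \<le> qprob N \<mu> j" "qprob N \<mu> j \<le> 1" by (simp_all add: qprob_def)
qed

theorem theorem5:
  fixes N0 N1 :: nat and S :: "nat set" and \<mu> \<alpha> \<beta> :: real
  assumes "N1 \<ge> 1"
    and "S \<subseteq> {..<N0 + N1}" and "card S = N1"
    and "\<mu> > 0"
    and "0 < \<alpha>" and "\<alpha> < 1" and "0 < \<beta>" and "\<beta> < 1"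
    and "\<exists>j\<in>{1..N1}.
           (\<Sum>s=1..j. 2 * measure (iid_gauss N1 \<mu>) {x \<in> space (iid_gauss N1 \<mu>). ord_stat N1 x s > 0} - 1)
           \<ge> (Cconst (N0 + N1) \<alpha> + Cconst (N0 + N1) (\<beta> / 2))
             * sqrt (real j + real (binom_upper_quantile (\<beta> / (2 * real N1)) N0 (qprob N1 \<mu> j)))"
  shows "measure (data_law (N0 + N1) S \<mu>)
           {Z \<in> space (data_law (N0 + N1) S \<mu>). rejects (N0 + N1) \<alpha> Z} \<ge> 1 - \<beta>"
proof -
  define n where "n = N0 + N1"
  define M where "M = data_law n S \<mu>"
  interpret M: prob_space M unfolding M_def by (rule prob_space_data_law)
  interpret P: prob_space "iid_gauss N1 \<mu>" by (rule iid_gauss_prob_space)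
  define \<gamma> where "\<gamma> = \<beta> / (2 * real N1)"
  define Ca where "Ca = Cconst n \<alpha>"
  define Cb where "Cb = Cconst n (\<beta> / 2)"
  have n1: "1 \<le> n" using assms(1) by (simp add: n_def)
  have C0: "0 < Ca" "0 < Cb"
    unfolding Ca_def Cb_def using assms n1 by (auto intro!: Cconst_bounds(1))
  obtain j where j: "1 \<le> j" "j \<le> N1" and
    cond: "(\<Sum>s=1..j. 2 * measure (iid_gauss N1 \<mu>) {x \<in> space (iid_gauss N1 \<mu>). ord_stat N1 x s > 0} - 1)
        \<ge> (Ca + Cb) * sqrt (real j + real (binom_upper_quantile \<gamma> N0 (qprob N1 \<mu> j)))"
    using assms(9) unfolding Ca_def Cb_def n_def \<gamma>_def by auto
  define t where "t = real (binom_upper_quantile \<gamma> N0 (qprob N1 \<mu> j))"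
  define m where "m = (\<Sum>s=1..j. 2 * measure (iid_gauss N1 \<mu>) {x \<in> space (iid_gauss N1 \<mu>). ord_stat N1 x s > 0} - 1)"
  define K where "K = real j + t"
  define u where "u = real j / (real N1 + 1)"
  have K: "0 < K" "real j \<le> K" using j by (auto simp: K_def t_def)
  have mC: "(Ca + Cb) * sqrt K \<le> m" using cond by (simp add: m_def K_def t_def)
  have mj: "m \<le> real j"
  proof -
    have "2 * measure (iid_gauss N1 \<mu>) B - 1 \<le> 1" for B
      using P.prob_le_1[of B] by linarith
    then have "m \<le> (\<Sum>s=1..j. 1)" unfolding m_def by (intro sum_mono)
    then show ?thesis by simp
  qed
  have u: "0 < u" "u < 1" using j by (auto simp: u_def)
  \<comment> \<open>The denominator \<open>N1 + 1\<close> matches the exchangeability bound; its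
    price is the shortfall \<open>u\<close> in the expected number of non-nulls above
    \<open>r\<close>.\<close>
  have jN: "real N1 * u = real j - u" by (simp add: u_def field_simps)
  obtain r where r: "0 \<le> r" "gtail \<mu> r = u"
    using gtail_surj[OF u] by blast
  have \<gamma>: "0 \<le> \<gamma>" "\<gamma> \<le> 1 / 2" "2 * \<gamma> \<le> 1 / real j"
  proof -
    show "0 \<le> \<gamma>" using assms by (simp add: \<gamma>_def)
    have "2 * \<gamma> = \<beta> / real N1" using assms(1) by (simp add: \<gamma>_def)
    also have "\<dots> \<le> 1 / real j" using assms j by (intro frac_le) auto
    finally show "2 * \<gamma> \<le> 1 / real j" .
    also have "\<dots> \<le> 1" using j by simp
    finally show "\<gamma> \<le> 1 / 2" by simp
  qed
  have \<tau>: "real N0 * gtail 0 r \<le> t + t / real j"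
  proof -
    define L where "L = real N0 * qprob N1 \<mu> j"
    \<comment> \<open>With this \<open>s\<close>, the term \<open>2 * \<gamma> \<le> s\<close> is
      absorbed by the unit gained from integrality, and
      \<open>1 - exp (- s) \<ge> s / (1 + s)\<close> produces exactly the factor
      \<open>1 + 1 / j\<close>.\<close>
    define s where "s = 1 / real j"
    have s: "0 < s" using j by (simp add: s_def)
    have "L * (1 - exp (- s)) \<le> s * (t - 1) + 2 * \<gamma>"
      unfolding L_def t_def using qprob_bounds \<gamma> s by (intro binomial_mean_le_quantile) auto
    also have "\<dots> \<le> s * t" using \<gamma>(3) unfolding s_def[symmetric] by (simp add: algebra_simps)
    finally have 1: "L * (1 - exp (- s)) \<le> s * t" .
    have "exp (- s) \<le> 1 / (1 + s)"
      using exp_ge_add_one_self[of s] s by (simp add: exp_minus inverse_eq_divide frac_le)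
    then have "s / (1 + s) \<le> 1 - exp (- s)" using s by (simp add: field_simps)
    then have "L * (s / (1 + s)) \<le> L * (1 - exp (- s))"
      using qprob_bounds by (intro mult_left_mono) (auto simp: L_def)
    with 1 have "s * (L / (1 + s)) \<le> s * t" by (simp add: mult.commute)
    then have "L / (1 + s) \<le> t" using s by (rule mult_left_le_imp_le)
    then have "L \<le> t + t * s" using s by (simp add: pos_divide_le_eq algebra_simps)
    moreover have "real N0 * gtail 0 r \<le> L"
      unfolding L_def using qprob_ge[OF j r(1), of \<mu>] r(2) by (intro mult_left_mono) (auto simp: u_def)
    ultimately show ?thesis by (simp add: s_def)
  qed
  define F where "F = (\<integral>y. sg y * indicator {y. \<bar>y\<bar> > r} y \<partial>gauss \<mu>)"
  \<comment> \<open>The loss against the threshold rule is \<open>a * (j - N1 * u) = a * u\<close>,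
    at most \<open>u\<close> because \<open>tanh\<close> stays below \<open>1\<close>.\<close>
  have F: "m - u \<le> real N1 * F"
  proof -
    define a where "a = tanh (\<mu> * r)"
    have "integrable (gauss \<mu>) (indicator {y. \<bar>y\<bar> > r} :: real \<Rightarrow> real)"
      "integrable (gauss \<mu>) (\<lambda>y. sg y * indicator {y. \<bar>y\<bar> > r} y)"
      by (intro gauss.integrable_const_bound[where B = 1]; auto simp: abs_mult)+
    then have "(\<integral>y. (sg y - a) * indicator {y. \<bar>y\<bar> > r} y \<partial>gauss \<mu>) = F - a * u"
      by (simp add: left_diff_distrib F_def r(2)[symmetric] gtail_def)
    then have "m \<le> real j * a + real N1 * (F - a * u)"
      using expected_top_signs_le[OF j(2) assms(4) r(1)] by (simp add: m_def a_def)
    also have "\<dots> = real N1 * F + a * (real j - real N1 * u)" by (simp add: algebra_simps)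
    also have "\<dots> = real N1 * F + a * u" by (simp add: jN)
    also have "a * u \<le> 1 * u" using u tanh_real_lt_1[of "\<mu> * r"] by (intro mult_right_mono) (auto simp: a_def)
    finally show ?thesis by simp
  qed
  \<comment> \<open>\<open>c\<close> is the slope at \<open>K\<close> of the rejection boundary \<open>Ca * sqrt k\<close>, so its tangent is \<open>c * (k + K)\<close>.\<close>
  define c where "c = Ca / (2 * sqrt K)"
  define \<theta> where "\<theta> = Cb / sqrt K"
  have c\<theta>: "0 \<le> \<theta>" "0 \<le> c" using C0 K by (auto simp: c_def \<theta>_def)
  \<comment> \<open>The choices of \<open>c\<close> and \<open>\<theta>\<close> turn the hypothesis
    on \<open>m\<close> into the linear condition that \<open>exponent_bound\<close>
    requires.\<close>
  have "(2 * c + \<theta>) * K = (Ca + Cb) * sqrt K"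
    using K by (simp add: c_def \<theta>_def field_simps)
  then have yK: "(2 * c + \<theta>) * (real j + t) \<le> m" using mC by (simp add: K_def)
  have K\<theta>: "K * \<theta>\<^sup>2 = Cb\<^sup>2" using K by (simp add: \<theta>_def power_divide)
  define X where "X = {Z \<in> space M. (\<Sum>i<n. if \<bar>Z i\<bar> > r then sg (Z i) - c else 0) \<le> c * K}"
  define A where "A = {Z \<in> space M. rejects n \<alpha> Z}"
  have "measure M X \<le> exp (\<theta> * (c * K) + (real N0 * gtail 0 r + real N1 * gtail \<mu> r) * (exp (\<theta> * c) * cosh \<theta> - 1)
           - exp (\<theta> * c) * sinh \<theta> * (real N1 * F))"
    unfolding X_def M_def n_def F_def by (rule threshold_sum_tail[OF assms(2,3) r(1) c\<theta>(1)])
  also have "\<dots> \<le> exp (5 / 4 - Cb\<^sup>2 / 2)"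
    using exponent_bound[OF c\<theta>, of "real j" t u m "real N0 * gtail 0 r" "real N1 * F"] j u yK mj \<tau> F
    by (simp add: r(2) jN K\<theta>[symmetric] K_def t_def)
  also have "\<dots> \<le> \<beta>"
    unfolding Cb_def by (rule Cconst_exp_le[OF n1 assms(7,8)])
  finally have X: "measure M X \<le> \<beta>" .
  \<comment> \<open>Without rejection the sum of signs is at most \<open>Ca * sqrt k\<close> for the
    random \<open>k\<close>. The tangent bound makes this linear in \<open>k\<close>, and
    \<open>c * k\<close> moves into the summands, which leaves a sum of independent terms.\<close>
  have "space M - A \<subseteq> X"
  proof
    fix Z assume Z: "Z \<in> space M - A"
    define k where "k = card {i. i < n \<and> \<bar>Z i\<bar> > r}"
    have "(\<Sum>i<n. if \<bar>Z i\<bar> > r then sg (Z i) else 0) \<le> Ca * sqrt (real k)"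
      using rejects_if_threshold_sum[OF n1 assms(5), of r Z] Z assms(6)
      by (force simp: A_def Ca_def k_def)
    also have "\<dots> = c * (2 * sqrt K * sqrt (real k))" using K by (simp add: c_def)
    also have "\<dots> \<le> c * (K + real k)"
    proof (intro mult_left_mono)
      have "0 \<le> (sqrt K - sqrt (real k))\<^sup>2" by simp
      also have "\<dots> = K + real k - 2 * sqrt K * sqrt (real k)" using K by (simp add: power2_diff)
      finally show "2 * sqrt K * sqrt (real k) \<le> K + real k" by simp
    qed (use c\<theta> in auto)
    finally have "(\<Sum>i<n. if \<bar>Z i\<bar> > r then sg (Z i) else 0) - c * real k \<le> c * K"
      by (simp add: algebra_simps)
    moreover have "(\<Sum>i<n. if \<bar>Z i\<bar> > r then sg (Z i) - c else 0)
        = (\<Sum>i<n. if \<bar>Z i\<bar> > r then sg (Z i) else 0) - c * real k"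
    proof -
      have "(\<Sum>i<n. if \<bar>Z i\<bar> > r then sg (Z i) - c else 0)
          = (\<Sum>i<n. if \<bar>Z i\<bar> > r then sg (Z i) else 0) - (\<Sum>i<n. if \<bar>Z i\<bar> > r then c else 0)"
        unfolding sum_subtractf[symmetric] by (intro sum.cong) auto
      also have "(\<Sum>i<n. if \<bar>Z i\<bar> > r then c else 0) = c * real k"
      proof -
        have "{..<n} \<inter> {i. \<bar>Z i\<bar> > r} = {i. i < n \<and> \<bar>Z i\<bar> > r}" by auto
        then show ?thesis by (simp add: sum.If_cases k_def)
      qed
      finally show ?thesis .
    qed
    ultimately show "Z \<in> X" using Z by (simp add: X_def)
  qed
  moreover have A: "A \<in> sets M" unfolding A_def M_def by (rule rejects_measurable)
  moreover have "X \<in> sets M"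
  proof -
    have "(\<lambda>Z. \<Sum>i<n. if \<bar>Z i\<bar> > r then sg (Z i) - c else 0) \<in> borel_measurable M"
    proof (intro borel_measurable_sum)
      fix i assume "i \<in> {..<n}"
      then have [measurable]: "(\<lambda>Z. Z i) \<in> borel_measurable M"
        unfolding M_def by (intro data_law_component) simp
      show "(\<lambda>Z. if \<bar>Z i\<bar> > r then sg (Z i) - c else 0) \<in> borel_measurable M" by measurable
    qed
    then show ?thesis unfolding X_def by measurable
  qed
  ultimately have "measure M (space M - A) \<le> measure M X"
    by (intro M.finite_measure_mono) auto
  with X M.prob_compl[OF A] have "1 - \<beta> \<le> measure M A" by linarith
  then show ?thesis by (simp add: A_def M_def n_def)
qed

end
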